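(* Let $n\ge 2$ be an integer and let $\lambda\le\Lambda$ be positive constants. If $u\in C(B_1)$ satisfies the inequality $\mathcal{M}^-_{\lambda,\Lambda}(D^2u)\le 0$ in $B_1\subset\mathbb{R}^n$ (in the viscosity sense), then $$\left|A_t^-(u,B_1)\cap B_{1/2}\right|\le C t^{-\varepsilon}$$ for all $t>t_0\sup_{B_1}|u|$, where the constants $C,t_0,\varepsilon$ depend only on $n,\lambda$ and $\Lambda$, with $$\varepsilon>\left(\frac{\lambda}{\lambda+(n-1)\Lambda}\right)^n\left(\frac{1}{4\sqrt n}\right)^n\frac{1}{\log\left[10^5 n^3(36n)^{\max\{1,\frac{(n-1)\Lambda}{\lambda}-1\}}\right]}.$$ Thus, the exponent $\varepsilon$ in the $W^{2,\varepsilon}$ estimate $$\left|\left\{x\in B_{1/2}:\underline\Theta(u,B_1)(x)>t\right\}\right|\le Ct^{-\varepsilon}\qquad\text{for all } t>t_0\sup_{B_1}|u|$$ (valid for all such $u$, with constants $C,t_0,\varepsilon>0$ depending only on $n,\lambda$ and $\Lambda$) satisfies $\varepsilon>(\Lambda/\lambda)^{-(n+1)}c(n)$, where $c(n)$ is a positive constant depending only on $n$.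
   Context: $B_r=\{y\in\mathbb{R}^n:|y|<r\}$; $|E|$ denotes the $n$-dimensional Lebesgue measure of a set $E$; $\log$ is the natural logarithm. $\mathcal S_n$ is the set of real symmetric $n\times n$ matrices, $I_n$ is the identity matrix and, for $0<\lambda\le\Lambda$ and $N\in\mathcal S_n$, $\mathcal{M}^-_{\lambda,\Lambda}(N)=\inf\{\operatorname{trace}(AN): A\in\mathcal S_n,\ \lambda I_n\le A\le\Lambda I_n\}$ is the Pucci extremal operator. For a domain $\Omega\subset\mathbb{R}^n$ and $v\in C(\Omega)$, the inequality $\mathcal{M}^-_{\lambda,\Lambda}(D^2v)\le 0$ in $\Omega$ is understood in the viscosity sense: whenever $\varphi$ is $C^2$ near $x_0\in\Omega$ and $v-\varphi$ has a local minimum at $x_0$, one has $\mathcal{M}^-_{\lambda,\Lambda}(D^2\varphi(x_0))\le 0$. For $v\in C(\Omega)$ and $K>0$, $$G_K^-(v,\Omega)=\{\bar x\in\Omega:\ \exists\, p\in\mathbb{R}^n \text{ such that } v(x)\ge v(\bar x)+p\cdot(x-\bar x)-\tfrac K2|x-\bar x|^2\ \ \forall x\in\Omega\},\qquad A_K^-(v,\Omega)=\Omega\setminus G_K^-(v,\Omega).$$ For $x\in\Omega$, $$\underline\Theta(v,\Omega)(x)=\inf\{A\ge 0:\ \exists\,p\in\mathbb{R}^n\text{ such that } v(y)\ge v(x)+p\cdot(y-x)-\tfrac12A|x-y|^2\ \ \forall y\in\Omega\},$$ with value $+\infty$ if no such $A$ exists.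
   Formalization: Both bounds C t^{-ε} are replaced by C (sup_{B_1}|u|)^ε t^{-ε}: as printed they fail under scaling u → Mu (take u = −|x_1|, M → ∞). For sup|u| ≤ 1 the printed bounds follow. *)

theory Defs
  imports "HOL-Analysis.Analysis"
begin

definition symmetric_mat :: "real^'n^'n \<Rightarrow> bool" where
  "symmetric_mat A \<longleftrightarrow> transpose A = A"

definition loewner_le :: "real^'n^'n \<Rightarrow> real^'n^'n \<Rightarrow> bool" where
  "loewner_le A B \<longleftrightarrow> (\<forall>x. x \<bullet> (A *v x) \<le> x \<bullet> (B *v x))"

text \<open>\<open>mat k\<close> is \<open>k\<close> times the identity matrix. For \<open>0 < lam \<le> Lam\<close> the set below is
  nonempty and bounded below, so \<open>Inf\<close> is the genuine infimum.\<close>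

definition pucci_minus :: "real \<Rightarrow> real \<Rightarrow> real^'n^'n \<Rightarrow> real" where
  "pucci_minus lam Lam N =
     Inf {trace (A ** N) | A. symmetric_mat A \<and> loewner_le (mat lam) A \<and> loewner_le A (mat Lam)}"

text \<open>\<open>phi\<close> is twice continuously differentiable on the open set \<open>U\<close>, with gradient \<open>g\<close> and
  Hessian matrix \<open>H\<close>; both are uniquely determined on \<open>U\<close>.\<close>

definition C2_on :: "(real^'n) set \<Rightarrow> (real^'n \<Rightarrow> real) \<Rightarrow> (real^'n \<Rightarrow> real^'n)
    \<Rightarrow> (real^'n \<Rightarrow> real^'n^'n) \<Rightarrow> bool" where
  "C2_on U phi g H \<longleftrightarrow>
     (\<forall>x\<in>U. (phi has_derivative (\<lambda>h. g x \<bullet> h)) (at x)) \<and>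
     (\<forall>x\<in>U. (g has_derivative (\<lambda>h. H x *v h)) (at x)) \<and>
     continuous_on U H"

definition visc_pucci_minus_le_0 ::
    "real \<Rightarrow> real \<Rightarrow> (real^'n) set \<Rightarrow> (real^'n \<Rightarrow> real) \<Rightarrow> bool" where
  "visc_pucci_minus_le_0 lam Lam \<Omega> v \<longleftrightarrow>
     (\<forall>x0\<in>\<Omega>. \<forall>U phi g H.
        open U \<and> x0 \<in> U \<and> C2_on U phi g H \<and>
        (\<forall>\<^sub>F y in at x0 within \<Omega>. v x0 - phi x0 \<le> v y - phi y)
        \<longrightarrow> pucci_minus lam Lam (H x0) \<le> 0)"

definition G_minus :: "real \<Rightarrow> (real^'n \<Rightarrow> real) \<Rightarrow> (real^'n) set \<Rightarrow> (real^'n) set" where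
  "G_minus K v \<Omega> = {x0\<in>\<Omega>. \<exists>p. \<forall>x\<in>\<Omega>.
     v x \<ge> v x0 + p \<bullet> (x - x0) - K / 2 * (norm (x - x0))\<^sup>2}"

definition A_minus :: "real \<Rightarrow> (real^'n \<Rightarrow> real) \<Rightarrow> (real^'n) set \<Rightarrow> (real^'n) set" where
  "A_minus K v \<Omega> = \<Omega> - G_minus K v \<Omega>"

text \<open>The infimum of the empty set in \<open>ereal\<close> is \<open>\<infinity>\<close>.\<close>

definition Theta_lower :: "(real^'n \<Rightarrow> real) \<Rightarrow> (real^'n) set \<Rightarrow> real^'n \<Rightarrow> ereal" where
  "Theta_lower v \<Omega> x = Inf {ereal A | A. A \<ge> 0 \<and> (\<exists>p. \<forall>y\<in>\<Omega>.
     v y \<ge> v x + p \<bullet> (y - x) - 1 / 2 * A * (norm (x - y))\<^sup>2)}"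

text \<open>Extended-real valued: for \<open>v\<close> unbounded on \<open>\<Omega>\<close> the value is \<open>\<infinity>\<close>.\<close>

definition sup_abs :: "(real^'n \<Rightarrow> real) \<Rightarrow> (real^'n) set \<Rightarrow> ereal" where
  "sup_abs v \<Omega> = (SUP x\<in>\<Omega>. ereal \<bar>v x\<bar>)"

end

theory Submission
  imports Defs
begin

text \<open>
  Two observations replace the usual regularisation, convex envelope and localising barrier.

  First, call \<open>x\<close> good for \<open>a\<close> if \<open>v = u + a|x|\<^sup>2/2\<close> has a supporting affine function at \<open>x\<close>.
  At two nearby good points the slopes \<open>q1\<close>, \<open>q2\<close> satisfy \<open>|q1 - q2| \<le> k |x1 - x2|\<close> for every
  \<open>k > (1 + \<kappa>) a\<close>, where \<open>\<kappa> = (n-1)\<Lambda>/\<lambda>\<close>: otherwise \<open>v\<close> lies above a convex kink so sharp that it is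
  touched from below by a quadratic polynomial violating the equation. So the slope map
  is Lipschitz on the good set with the sharp constant, and Vitali's covering theorem alone bounds
  the measure of its image.

  Second, let \<open>r\<close> be the distance of \<open>x\<close> to the good set for \<open>t\<close>, attained at \<open>x0\<close>. Adding paraboloids of
  opening \<open>K t\<close> with vertices in \<open>ball x (r/2)\<close> to the supporting paraboloid at \<open>x0\<close> produces contact
  points in \<open>ball x (2 r)\<close>. If such a contact point were good for \<open>t\<close>, its slope would differ too much from the
  slope at \<open>x0\<close>, by the first observation, as soon as \<open>K \<ge> 8 (1 + \<kappa>)\<close>. Hence a fixed fraction of the ball is
  good for \<open>(K+1) t\<close> but not for \<open>t\<close>. A covering argument and iteration give the power decay; since \<open>K\<close>
  is linear in \<open>\<kappa>\<close>, only \<open>ln \<kappa>\<close> enters the denominator of the exponent. As \<open>r\<close> is at most \<open>2 sqrt (sup |u| / t)\<close>,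
  the radii lost in the iteration are summable.
\<close>

section \<open>The Pucci operator on axially symmetric matrices\<close>

text \<open>The matrix \<open>\<alpha> e e^T - \<beta> I\<close>: for a unit vector \<open>e\<close>
  its eigenvalues are \<open>\<alpha> - \<beta>\<close> along \<open>e\<close> and
  \<open>- \<beta>\<close> on the orthogonal complement. It is the Hessian of the test function in
  \<open>no_convex_kink\<close>.\<close>

definition axial_mat :: "real \<Rightarrow> real \<Rightarrow> real^'n \<Rightarrow> real^'n^'n" where
  "axial_mat \<alpha> \<beta> e = (\<chi> i j. \<alpha> * (e $ i * e $ j) - (if i = j then \<beta> else 0))"

lemma axial_mat_mult_vec: "axial_mat \<alpha> \<beta> e *v x = (\<alpha> * (e \<bullet> x)) *\<^sub>R e - \<beta> *\<^sub>R x"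
proof -
  have "(\<Sum>j\<in>UNIV. (\<alpha> * (e $ i * e $ j) - (if i = j then \<beta> else 0)) * x $ j)
      = (\<Sum>j\<in>UNIV. \<alpha> * (e $ i * e $ j) * x $ j - (if i = j then \<beta> * x $ j else 0))" for i
    by (auto intro!: sum.cong simp: algebra_simps)
  then show ?thesis
    by (simp add: vec_eq_iff axial_mat_def matrix_vector_mult_def inner_vec_def
        sum_subtractf sum_distrib_left mult_ac)
qed

lemma trace_mult_axial_mat:
  "trace (A ** axial_mat \<alpha> \<beta> e) = \<alpha> * (e \<bullet> (A *v e)) - \<beta> * trace A"
proof -
  have "trace (A ** axial_mat \<alpha> \<beta> e)
      = (\<Sum>i\<in>UNIV. \<Sum>k\<in>UNIV. \<alpha> * (e $ i * (A $ i $ k * e $ k)) - (if k = i then \<beta> * A $ i $ k else 0))"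
    unfolding trace_def matrix_matrix_mult_def axial_mat_def
    by (auto intro!: sum.cong simp: algebra_simps)
  also have "\<dots> = \<alpha> * (e \<bullet> (A *v e)) - \<beta> * trace A"
    by (simp add: sum_subtractf inner_vec_def matrix_vector_mult_def trace_def sum_distrib_left)
  finally show ?thesis .
qed

text \<open>An orthogonal change of basis taking a coordinate vector to \<open>e\<close> turns the
  form at \<open>e\<close> into a diagonal entry; the other diagonal entries are
  nonnegative.\<close>

lemma inner_le_trace_if_psd:
  fixes B :: "real^'n^'n" and e :: "real^'n"
  assumes psd: "\<And>x. 0 \<le> x \<bullet> (B *v x)" and e: "norm e = 1"
  shows "e \<bullet> (B *v e) \<le> trace B"
proof -
  fix k :: 'n
  obtain Q :: "real^'n^'n" where Q: "orthogonal_matrix Q" "Q *v (axis k 1) = e"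
    using orthogonal_matrix_exists_basis[OF e] by metis
  have *: "(transpose Q ** B ** Q) $ i $ i = (Q *v axis i 1) \<bullet> (B *v (Q *v axis i 1))" for i
  proof -
    have "(transpose Q ** B ** Q) $ i $ i = axis i 1 \<bullet> ((transpose Q ** B ** Q) *v axis i 1)"
      by (simp add: inner_axis' matrix_vector_mul_component row_def column_def matrix_vector_mult_basis)
    also have "\<dots> = axis i 1 \<bullet> (transpose Q *v (B *v (Q *v axis i 1)))"
      by (simp add: matrix_vector_mul_assoc matrix_mul_assoc)
    also have "\<dots> = (Q *v axis i 1) \<bullet> (B *v (Q *v axis i 1))"
      by (metis dot_lmul_matrix vector_transpose_matrix transpose_transpose)
    finally show ?thesis .
  qed
  have "trace B = trace (B ** (Q ** transpose Q))"
    using Q(1) by (simp add: orthogonal_matrix_def)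
  also have "\<dots> = trace (transpose Q ** B ** Q)"
    by (metis matrix_mul_assoc trace_mul_sym)
  also have "\<dots> = (\<Sum>i\<in>UNIV. (Q *v axis i 1) \<bullet> (B *v (Q *v axis i 1)))"
    by (simp add: trace_def *)
  also have "\<dots> \<ge> (Q *v axis k 1) \<bullet> (B *v (Q *v axis k 1))"
    by (rule member_le_sum) (use psd in auto)
  finally show ?thesis using Q(2) by simp
qed

text \<open>Split \<open>trace A\<close> into \<open>e \<bullet> (A *v e)\<close> and a rest. By
  \<open>inner_le_trace_if_psd\<close> for \<open>mat Lam - A\<close> the rest is at most
  \<open>(n - 1) Lam\<close>; the part along \<open>e\<close> is at least \<open>lam\<close> and
  enters with coefficient \<open>\<alpha> - \<beta> \<ge> 0\<close>.\<close>

lemma pucci_minus_axial_mat_ge: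
  fixes e :: "real^'n"
  assumes lam: "lam \<le> Lam" and e: "norm e = 1" and \<beta>: "0 \<le> \<beta>" "\<beta> \<le> \<alpha>"
  shows "(\<alpha> - \<beta>) * lam - \<beta> * (real CARD('n) - 1) * Lam \<le> pucci_minus lam Lam (axial_mat \<alpha> \<beta> e)"
  unfolding pucci_minus_def
proof (rule cInf_greatest)
  have mat_mult: "mat c *v x = c *\<^sub>R x" for c and x :: "real^'n"
  proof -
    have "(if i = j then c else 0) * x $ j = (if i = j then c * x $ j else 0)" for i j :: 'n by simp
    then show ?thesis by (simp add: vec_eq_iff matrix_vector_mult_def mat_def)
  qed
  have "symmetric_mat (mat lam :: real^'n^'n)" "loewner_le (mat lam :: real^'n^'n) (mat Lam)"
    "loewner_le (mat lam :: real^'n^'n) (mat lam)"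
    using lam by (auto simp: symmetric_mat_def loewner_le_def mat_mult mult_right_mono)
  then show "{trace (A ** axial_mat \<alpha> \<beta> e) |A.
      symmetric_mat A \<and> loewner_le (mat lam) A \<and> loewner_le A (mat Lam)} \<noteq> {}"
    by blast
  have ee: "e \<bullet> e = 1" using e by (simp add: dot_square_norm)
  fix x assume "x \<in> {trace (A ** axial_mat \<alpha> \<beta> e) |A.
      symmetric_mat A \<and> loewner_le (mat lam) A \<and> loewner_le A (mat Lam)}"
  then obtain A where A: "loewner_le (mat lam) A" "loewner_le A (mat Lam)"
    and x: "x = \<alpha> * (e \<bullet> (A *v e)) - \<beta> * trace A"
    by (auto simp: trace_mult_axial_mat)
  have low: "lam \<le> e \<bullet> (A *v e)"
    using A(1) ee unfolding loewner_le_def mat_mult by (metis inner_scaleR_right mult.right_neutral)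
  have "e \<bullet> ((mat Lam - A) *v e) \<le> trace (mat Lam - A)"
    using A(2) by (intro inner_le_trace_if_psd e) (simp add: loewner_le_def matrix_vector_mult_diff_rdistrib inner_diff_right)
  moreover have "e \<bullet> (mat Lam *v e) = Lam" "trace (mat Lam :: real^'n^'n) = real CARD('n) * Lam"
    by (simp add: mat_mult ee) (simp add: trace_def mat_def)
  ultimately have "trace A \<le> (real CARD('n) - 1) * Lam + e \<bullet> (A *v e)"
    by (simp add: matrix_vector_mult_diff_rdistrib inner_diff_right trace_sub algebra_simps)
  from mult_left_mono[OF this \<beta>(1)] mult_left_mono[OF low, of "\<alpha> - \<beta>"] \<beta>(2)
  show "(\<alpha> - \<beta>) * lam - \<beta> * (real CARD('n) - 1) * Lam \<le> x"
    unfolding x by (simp add: algebra_simps)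
qed

section \<open>Slopes at good points\<close>

text \<open>\<open>q\<close> is a subgradient at \<open>x\<close> of \<open>u + a/2 |z|^2\<close>,
  relative to all of \<open>\<Omega>\<close>. Adding the quadratic turns contact with concave
  paraboloids of opening \<open>a\<close> into contact with affine functions.\<close>

definition lower_grad :: "real \<Rightarrow> (real^'n \<Rightarrow> real) \<Rightarrow> (real^'n) set \<Rightarrow> real^'n \<Rightarrow> real^'n \<Rightarrow> bool" where
  "lower_grad a u \<Omega> x q \<longleftrightarrow> x \<in> \<Omega> \<and>
     (\<forall>z\<in>\<Omega>. u x + a / 2 * (x \<bullet> x) + q \<bullet> (z - x) \<le> u z + a / 2 * (z \<bullet> z))"

text \<open>
  The test function is the affine part plus \<open>k/2 (e \<bullet> z - c)\<^sup>2\<close> minus a small multiple of the squared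
  distance to the line through \<open>x\<close> in direction \<open>e\<close>. In the slab \<open>|e \<bullet> z - c| \<le> \<rho>\<close> it touches \<open>u\<close> at an
  interior point.
\<close>

lemma no_convex_kink:
  fixes u :: "real^'n \<Rightarrow> real"
  assumes lam: "0 < lam" "lam \<le> Lam" and "continuous_on \<Omega> u"
    and visc: "visc_pucci_minus_le_0 lam Lam \<Omega> u"
    and R: "0 < R" "cball x R \<subseteq> \<Omega>" and e: "norm e = 1" and "0 \<le> a" "0 < \<delta>"
    and below: "\<And>z. z \<in> \<Omega> \<Longrightarrow> m + b \<bullet> z + s / 2 * \<bar>e \<bullet> z - c\<bar> \<le> u z + a / 2 * (z \<bullet> z)"
    and at_x: "m + b \<bullet> x + s / 2 * \<bar>e \<bullet> x - c\<bar> = u x + a / 2 * (x \<bullet> x)"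
    and k: "(a + \<delta>) * (real CARD('n) - 1) * Lam < (k - a) * lam"
    and small: "2 * k * \<bar>e \<bullet> x - c\<bar> < s" "4 * \<bar>e \<bullet> x - c\<bar> < R" "2 * s * \<bar>e \<bullet> x - c\<bar> \<le> \<delta> * R\<^sup>2"
  shows False
proof -
  have n1: "1 \<le> real CARD('n)" by (simp add: Suc_leI)
  have "0 \<le> (a + \<delta>) * (real CARD('n) - 1) * Lam" using assms n1 by simp
  with k lam have "a < k" by (smt (verit) mult_nonneg_nonneg zero_less_mult_pos2)
  with \<open>0 \<le> a\<close> have "0 < k" by simp
  define h where "h = (\<lambda>z. e \<bullet> z - c)"
  \<comment> \<open>The profile \<open>s/2 \<tau> - k/2 \<tau>^2\<close> increases up to
    \<open>s / (2 * k)\<close>, so \<open>u - \<phi>\<close> is larger on the faces of the slab than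
    at \<open>x\<close>. The bound \<open>R / 4\<close> keeps \<open>|e \<bullet> (z - x)|\<close>
    below \<open>R / 2\<close> in the slab.\<close>
  define \<rho> where "\<rho> = min (s / (2 * k)) (R / 4)"
  have \<rho>: "\<bar>h x\<bar> < \<rho>" "\<rho> \<le> s / (2 * k)" "\<rho> \<le> R / 4"
    using small \<open>0 < k\<close> by (auto simp: \<rho>_def h_def field_simps)
  have "0 < s" using \<rho> \<open>0 < k\<close> by (smt (verit) zero_less_divide_iff)
  define N where "N = (\<lambda>z. (z - x) \<bullet> (z - x) - (e \<bullet> (z - x))\<^sup>2)"
  define \<phi> where "\<phi> = (\<lambda>z. m + b \<bullet> z - a / 2 * (z \<bullet> z) + k / 2 * (h z)\<^sup>2 - \<delta> / 2 * N z)"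
  define D where "D = cball x R \<inter> {z. \<bar>h z\<bar> \<le> \<rho>}"
  have cont_h: "continuous_on S h" for S unfolding h_def by (intro continuous_intros)
  have closedD: "closed {z. \<bar>h z\<bar> \<le> \<rho>}"
    by (intro closed_Collect_le continuous_intros cont_h)
  then have "compact D" unfolding D_def by (intro compact_Int_closed) auto
  have "x \<in> D" using \<rho> R by (auto simp: D_def)
  have "D \<subseteq> \<Omega>" using R by (auto simp: D_def)
  have "continuous_on D (\<lambda>z. u z - \<phi> z)"
    unfolding \<phi>_def N_def
    by (intro continuous_intros cont_h continuous_on_subset[OF \<open>continuous_on \<Omega> u\<close> \<open>D \<subseteq> \<Omega>\<close>])
  then obtain z0 where z0: "z0 \<in> D" and min: "\<And>z. z \<in> D \<Longrightarrow> u z0 - \<phi> z0 \<le> u z - \<phi> z"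
    using continuous_attains_inf[OF \<open>compact D\<close>] \<open>x \<in> D\<close> by blast
  have lower: "s / 2 * \<bar>h z\<bar> - k / 2 * (h z)\<^sup>2 + \<delta> / 2 * N z \<le> u z - \<phi> z" if "z \<in> D" for z
    using below[of z] that \<open>D \<subseteq> \<Omega>\<close> by (auto simp: \<phi>_def h_def)
  have at_x': "u x - \<phi> x = s / 2 * \<bar>h x\<bar> - k / 2 * (h x)\<^sup>2"
    using at_x by (simp add: \<phi>_def h_def N_def)
  have N_nonneg: "0 \<le> N z" for z
  proof -
    have "\<bar>e \<bullet> (z - x)\<bar> \<le> norm (z - x)" using Cauchy_Schwarz_ineq2[of e "z - x"] e by simp
    then show ?thesis unfolding N_def by (metis abs_le_square_iff abs_norm_cancel diff_ge_0_iff_ge power2_norm_eq_inner)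
  qed
  have not_h: "\<bar>h z0\<bar> < \<rho>"
  proof (rule ccontr)
    assume "\<not> \<bar>h z0\<bar> < \<rho>"
    with z0 have eq: "\<bar>h z0\<bar> = \<rho>" by (auto simp: D_def)
    have "0 < (\<rho> - \<bar>h x\<bar>) * (s - k * (\<rho> + \<bar>h x\<bar>))"
    proof (rule mult_pos_pos)
      have "k * (\<rho> + \<bar>h x\<bar>) < k * (s / (2 * k) + s / (2 * k))"
        using \<rho> \<open>0 < k\<close> by (intro mult_strict_left_mono) auto
      then show "0 < s - k * (\<rho> + \<bar>h x\<bar>)" using \<open>0 < k\<close> by (simp add: field_simps)
    qed (use \<rho> in simp)
    then have "s / 2 * \<bar>h x\<bar> - k / 2 * \<bar>h x\<bar>\<^sup>2 < s / 2 * \<rho> - k / 2 * \<rho>\<^sup>2"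
      by (simp add: algebra_simps power2_eq_square)
    moreover have "s / 2 * \<rho> - k / 2 * \<rho>\<^sup>2 \<le> u z0 - \<phi> z0"
    proof -
      have "0 \<le> \<delta> / 2 * N z0" using N_nonneg \<open>0 < \<delta>\<close> by simp
      moreover have "(h z0)\<^sup>2 = \<rho>\<^sup>2" using eq by (metis power2_abs)
      ultimately show ?thesis using lower[OF z0] eq by simp
    qed
    ultimately show False using min[OF \<open>x \<in> D\<close>] at_x' by simp
  qed
  \<comment> \<open>On the sphere the squared distance to the line is at least
    \<open>3/4 R^2\<close>. The penalty \<open>3/8 \<delta> R^2\<close> then exceeds the value at
    \<open>x\<close>, which the last smallness hypothesis bounds by
    \<open>\<delta> R^2 / 4\<close>.\<close>
  have not_R: "norm (z0 - x) < R"
  proof (rule ccontr)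
    assume "\<not> norm (z0 - x) < R"
    with z0 have eq: "norm (z0 - x) = R" by (auto simp: D_def dist_norm norm_minus_commute)
    have "e \<bullet> (z0 - x) = h z0 - h x" by (simp add: h_def inner_diff_right)
    with not_h \<rho> have "\<bar>e \<bullet> (z0 - x)\<bar> \<le> \<bar>R / 2\<bar>" by linarith
    then have "(e \<bullet> (z0 - x))\<^sup>2 \<le> (R / 2)\<^sup>2" by (simp only: abs_le_square_iff)
    then have "3 / 4 * R\<^sup>2 \<le> N z0"
      unfolding N_def using eq by (simp add: power2_norm_eq_inner[symmetric] power_divide)
    with \<open>0 < \<delta>\<close> have 1: "\<delta> / 2 * (3 / 4 * R\<^sup>2) \<le> \<delta> / 2 * N z0"
      by (intro mult_left_mono) auto
    have "0 \<le> \<bar>h z0\<bar> * (s - k * \<bar>h z0\<bar>)"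
    proof (intro mult_nonneg_nonneg)
      have "k * \<bar>h z0\<bar> \<le> k * (s / (2 * k))" using not_h \<rho> \<open>0 < k\<close> by (intro mult_left_mono) auto
      then show "0 \<le> s - k * \<bar>h z0\<bar>" using \<open>0 < k\<close> \<open>0 < s\<close> by simp
    qed simp
    then have 2: "0 \<le> s / 2 * \<bar>h z0\<bar> - k / 2 * (h z0)\<^sup>2"
      by (simp add: algebra_simps power2_eq_square)
    have 3: "0 < \<delta> * R\<^sup>2" using \<open>0 < \<delta>\<close> R by simp
    have 4: "0 \<le> k / 2 * (h x)\<^sup>2" using \<open>0 < k\<close> by simp
    have "s / 2 * \<bar>h x\<bar> \<le> \<delta> * R\<^sup>2 / 4" using small(3) by (simp add: h_def)
    with 1 2 3 4 lower[OF z0] min[OF \<open>x \<in> D\<close>] at_x' show False by linarith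
  qed
  let ?W = "ball x R \<inter> {z. \<bar>h z\<bar> < \<rho>}"
  have "open ?W" by (intro open_Int open_ball open_Collect_less continuous_intros cont_h)
  moreover have "z0 \<in> ?W" using not_h not_R by (simp add: dist_norm norm_minus_commute)
  moreover have "?W \<subseteq> D" by (auto simp: D_def)
  ultimately have "\<forall>\<^sub>F y in at z0 within \<Omega>. u z0 - \<phi> z0 \<le> u y - \<phi> y"
    unfolding eventually_at_topological using min by blast
  \<comment> \<open>The Hessian is the sum of \<open>- a I\<close>, \<open>k e e^T\<close> and
    \<open>- \<delta> (I - e e^T)\<close>. Hypothesis \<open>k\<close> says exactly that the lower
    bound of its Pucci value is positive.\<close>
  moreover have "C2_on UNIV \<phi>
      (\<lambda>z. b - a *\<^sub>R z + (k * h z) *\<^sub>R e - \<delta> *\<^sub>R ((z - x) - (e \<bullet> (z - x)) *\<^sub>R e))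
      (\<lambda>z. axial_mat (k + \<delta>) (a + \<delta>) e)"
    unfolding C2_on_def
  proof (intro conjI ballI)
    fix z :: "real^'n"
    show "(\<phi> has_derivative (\<lambda>w. (b - a *\<^sub>R z + (k * h z) *\<^sub>R e
        - \<delta> *\<^sub>R ((z - x) - (e \<bullet> (z - x)) *\<^sub>R e)) \<bullet> w)) (at z)"
      unfolding \<phi>_def N_def h_def
      by (auto intro!: derivative_eq_intros simp: fun_eq_iff algebra_simps inner_simps inner_commute
          power2_eq_square)
    show "((\<lambda>z. b - a *\<^sub>R z + (k * h z) *\<^sub>R e - \<delta> *\<^sub>R ((z - x) - (e \<bullet> (z - x)) *\<^sub>R e))
        has_derivative (*v) (axial_mat (k + \<delta>) (a + \<delta>) e)) (at z)"
      unfolding axial_mat_mult_vec h_def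
      by (auto intro!: derivative_eq_intros simp: fun_eq_iff algebra_simps inner_simps)
  qed (rule continuous_on_const)
  ultimately have "pucci_minus lam Lam (axial_mat (k + \<delta>) (a + \<delta>) e) \<le> 0"
    using visc z0 \<open>D \<subseteq> \<Omega>\<close> unfolding visc_pucci_minus_le_0_def by (blast intro: open_UNIV UNIV_I)
  moreover have "((k + \<delta>) - (a + \<delta>)) * lam - (a + \<delta>) * (real CARD('n) - 1) * Lam
      \<le> pucci_minus lam Lam (axial_mat (k + \<delta>) (a + \<delta>) e)"
    using \<open>0 \<le> a\<close> \<open>0 < \<delta>\<close> \<open>a < k\<close> by (intro pucci_minus_axial_mat_ge lam e) auto
  ultimately show False using k by simp
qed

text \<open>The maximum of the two supporting planes is a kink below \<open>u + a/2 |z|^2\<close>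
  with slope jump \<open>norm (q1 - q2)\<close>. Its crease runs between \<open>x1\<close> and
  \<open>x2\<close>, so one of them is within half their distance of it. A jump above
  \<open>k * norm (x1 - x2)\<close> makes \<open>no_convex_kink\<close> apply at that point.\<close>

lemma lower_grad_lipschitz:
  fixes u :: "real^'n \<Rightarrow> real"
  assumes lam: "0 < lam" "lam \<le> Lam" and u: "continuous_on \<Omega> u" "visc_pucci_minus_le_0 lam Lam \<Omega> u"
    and g: "lower_grad a u \<Omega> x1 q1" "lower_grad a u \<Omega> x2 q2"
    and R: "0 < R" "cball x1 R \<subseteq> \<Omega>" "cball x2 R \<subseteq> \<Omega>" and a: "0 \<le> a" "0 < \<delta>"
    and k: "(a + \<delta>) * (real CARD('n) - 1) * Lam < (k - a) * lam"
    and small: "2 * norm (x1 - x2) < R" "norm (q1 - q2) * norm (x1 - x2) \<le> \<delta> * R\<^sup>2"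
  shows "norm (q1 - q2) \<le> k * norm (x1 - x2)"
proof (rule ccontr)
  define s d where "s = norm (q2 - q1)" and "d = norm (x2 - x1)"
  assume "\<not> ?thesis"
  then have big: "k * d < s" by (simp add: s_def d_def norm_minus_commute)
  have n1: "1 \<le> real CARD('n)" by (simp add: Suc_leI)
  have "0 \<le> (a + \<delta>) * (real CARD('n) - 1) * Lam" using lam a n1 by simp
  with k lam have "a < k" by (smt (verit) mult_nonneg_nonneg zero_less_mult_pos2)
  with a have "0 < k" by simp
  have "0 \<le> k * d" using \<open>0 < k\<close> by (simp add: d_def)
  with big have "0 < s" by linarith
  define e where "e = (1 / s) *\<^sub>R (q2 - q1)"
  have e: "norm e = 1" using \<open>0 < s\<close> by (simp add: e_def s_def[symmetric])
  have q2: "q2 = q1 + s *\<^sub>R e" using \<open>0 < s\<close> by (simp add: e_def)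
  define v where "v = (\<lambda>z. u z + a / 2 * (z \<bullet> z))"
  have l1: "v x1 + q1 \<bullet> (z - x1) \<le> v z" and l2: "v x2 + q2 \<bullet> (z - x2) \<le> v z" if "z \<in> \<Omega>" for z
    using g that by (auto simp: lower_grad_def v_def)
  have x12: "x1 \<in> \<Omega>" "x2 \<in> \<Omega>" using g by (auto simp: lower_grad_def)
  \<comment> \<open>\<open>c\<close> locates the crease and \<open>m + b \<bullet> z\<close> is the
    mean of the two planes, which are this mean minus and plus
    \<open>s / 2 * (e \<bullet> z - c)\<close>.\<close>
  define c where "c = (v x1 - q1 \<bullet> x1 - v x2 + q2 \<bullet> x2) / s"
  define m where "m = (v x1 - q1 \<bullet> x1 + v x2 - q2 \<bullet> x2) / 2"
  define b where "b = (1 / 2) *\<^sub>R (q1 + q2)"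
  have sc: "s * c = v x1 - q1 \<bullet> x1 - v x2 + q2 \<bullet> x2" using \<open>0 < s\<close> by (simp add: c_def)
  have b: "b \<bullet> z = (q1 \<bullet> z + q2 \<bullet> z) / 2" "q2 \<bullet> z = q1 \<bullet> z + s * (e \<bullet> z)" for z
    by (simp_all add: b_def inner_add_left) (simp add: q2 inner_add_left)
  have f1: "m + b \<bullet> z - s / 2 * (e \<bullet> z - c) = v x1 + q1 \<bullet> (z - x1)"
    and f2: "m + b \<bullet> z + s / 2 * (e \<bullet> z - c) = v x2 + q2 \<bullet> (z - x2)" for z
    using sc b by (simp_all add: m_def inner_diff_right algebra_simps add_divide_distrib diff_divide_distrib)
  have below: "m + b \<bullet> z + s / 2 * \<bar>e \<bullet> z - c\<bar> \<le> u z + a / 2 * (z \<bullet> z)" if "z \<in> \<Omega>" for z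
    using l1[OF that] l2[OF that] f1[of z] f2[of z] unfolding v_def
    by (cases "0 \<le> e \<bullet> z - c") (simp_all only: abs_of_nonneg abs_of_neg not_le mult_minus_right)
  \<comment> \<open>At \<open>x1\<close> the first plane touches \<open>v\<close>, so the second one
    cannot lie above it; at \<open>x2\<close> the roles are exchanged.\<close>
  have h1: "e \<bullet> x1 - c \<le> 0"
  proof -
    have "s * (e \<bullet> x1 - c) \<le> 0" using f1[of x1] f2[of x1] l2[OF x12(1)] by simp
    with \<open>0 < s\<close> show ?thesis by (simp add: mult_le_0_iff)
  qed
  have h2: "0 \<le> e \<bullet> x2 - c"
  proof -
    have "0 \<le> s * (e \<bullet> x2 - c)" using f1[of x2] f2[of x2] l1[OF x12(2)] by simp
    with \<open>0 < s\<close> show ?thesis by (simp add: zero_le_mult_iff)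
  qed
  have at1: "m + b \<bullet> x1 + s / 2 * \<bar>e \<bullet> x1 - c\<bar> = u x1 + a / 2 * (x1 \<bullet> x1)"
    using f1[of x1] unfolding abs_of_nonpos[OF h1] mult_minus_right v_def by simp
  have at2: "m + b \<bullet> x2 + s / 2 * \<bar>e \<bullet> x2 - c\<bar> = u x2 + a / 2 * (x2 \<bullet> x2)"
    using f2[of x2] h2 by (simp add: v_def abs_if)
  have "e \<bullet> (x2 - x1) \<le> d" using norm_cauchy_schwarz[of e "x2 - x1"] e by (simp add: d_def)
  then have "(e \<bullet> x2 - c) - (e \<bullet> x1 - c) \<le> d" by (simp add: inner_diff_right)
  with h1 h2 have "2 * \<bar>e \<bullet> x1 - c\<bar> \<le> d \<or> 2 * \<bar>e \<bullet> x2 - c\<bar> \<le> d"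
    unfolding abs_of_nonpos[OF h1] abs_of_nonneg[OF h2] by (simp add: not_le) linarith
  then obtain x where x: "cball x R \<subseteq> \<Omega>" "m + b \<bullet> x + s / 2 * \<bar>e \<bullet> x - c\<bar> = u x + a / 2 * (x \<bullet> x)"
    "2 * \<bar>e \<bullet> x - c\<bar> \<le> d"
    using at1 at2 R by metis
  show False
  proof (rule no_convex_kink[OF lam u R(1) x(1) e a below x(2) k])
    show "2 * k * \<bar>e \<bullet> x - c\<bar> < s"
    proof -
      have "k * (2 * \<bar>e \<bullet> x - c\<bar>) \<le> k * d" using x(3) \<open>0 < k\<close> by (intro mult_left_mono) auto
      moreover have "k * (2 * \<bar>e \<bullet> x - c\<bar>) = 2 * k * \<bar>e \<bullet> x - c\<bar>" by simp
      ultimately show ?thesis using big by linarith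
    qed
    show "4 * \<bar>e \<bullet> x - c\<bar> < R" using x(3) small(1) by (simp add: d_def norm_minus_commute)
    have "s * (2 * \<bar>e \<bullet> x - c\<bar>) \<le> s * d" using x(3) \<open>0 < s\<close> by (intro mult_left_mono) auto
    then show "2 * s * \<bar>e \<bullet> x - c\<bar> \<le> \<delta> * R\<^sup>2"
      using small(2) by (simp add: s_def d_def norm_minus_commute)
  qed
qed

section \<open>Measure of the set of slopes\<close>

text \<open>Disjoint Vitali balls centred in \<open>S\<close> cover it up to a null set inside an
  open set barely larger than \<open>E\<close>; \<open>f\<close> sends the part of \<open>S\<close>
  in a ball of radius \<open>r\<close> into a ball of radius \<open>L r\<close>, and null sets to
  null sets. As neither \<open>S\<close> nor its image need be measurable, the estimate is between a
  superset \<open>E\<close> and a subset \<open>B\<close>.\<close>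

lemma measure_le_locally_Lipschitz_image:
  fixes f :: "'a::euclidean_space \<Rightarrow> 'a"
  assumes E: "E \<in> lmeasurable" "S \<subseteq> E" and pos: "0 < L" "0 < d"
    and lip: "\<And>x y. x \<in> S \<Longrightarrow> y \<in> S \<Longrightarrow> norm (x - y) < d \<Longrightarrow> norm (f x - f y) \<le> L * norm (x - y)"
    and B: "B \<in> sets lebesgue" "B \<subseteq> f ` S"
  shows "measure lebesgue B \<le> L ^ DIM('a) * measure lebesgue E"
proof (rule field_le_epsilon)
  fix \<epsilon> :: real assume "0 < \<epsilon>"
  define n where "n = DIM('a)"
  have "0 < \<epsilon> / L ^ n" using \<open>0 < \<epsilon>\<close> pos by simp
  then obtain T where T: "open T" "E \<subseteq> T" "T - E \<in> lmeasurable" "emeasure lebesgue (T - E) < ennreal (\<epsilon> / L ^ n)"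
    using sets_lebesgue_outer_open fmeasurableD[OF E(1)] by metis
  have "T = E \<union> (T - E)" using T by blast
  then have Tm: "T \<in> lmeasurable" using E T by (metis fmeasurable.Un)
  have "measure lebesgue (T - E) \<le> \<epsilon> / L ^ n"
    using T(3,4) \<open>0 < \<epsilon> / L ^ n\<close> by (simp add: emeasure_eq_measure2 ennreal_less_iff)
  then have mT: "measure lebesgue T \<le> measure lebesgue E + \<epsilon> / L ^ n"
    using measurable_measure_Diff[of T lebesgue E] Tm E T(2) by (simp add: fmeasurableD)
  \<comment> \<open>Radii below \<open>d\<close> make the Lipschitz bound available between the
    centre and every point of \<open>S\<close> in the ball.\<close>
  define K where "K = {(x, r). x \<in> S \<and> 0 < r \<and> r < d \<and> cball x r \<subseteq> T}"
  obtain C where C: "countable C" "C \<subseteq> K"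
      "pairwise (\<lambda>i j. disjnt (cball (fst i) (snd i)) (cball (fst j) (snd j))) C"
      "negligible (S - (\<Union>i\<in>C. cball (fst i) (snd i)))"
  proof (rule Vitali_covering_theorem_cballs[of K snd S fst])
    show "0 < snd i" if "i \<in> K" for i using that by (auto simp: K_def)
    fix x \<delta> assume "x \<in> S" "0 < (\<delta>::real)"
    then have "x \<in> T" using T E by blast
    then obtain r where r: "0 < r" "cball x r \<subseteq> T" using T open_contains_cball by blast
    define r' where "r' = min r (min (d / 2) (\<delta> / 2))"
    have "0 < r'" "r' \<le> r" "r' < d" "r' < \<delta>" using r pos \<open>0 < \<delta>\<close> by (auto simp: r'_def)
    moreover have "cball x r' \<subseteq> T" using r \<open>r' \<le> r\<close> by (meson order_trans subset_cball)
    ultimately show "\<exists>i. i \<in> K \<and> x \<in> cball (fst i) (snd i) \<and> snd i < \<delta>"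
      using \<open>x \<in> S\<close> by (intro exI[of _ "(x, r')"]) (simp add: K_def)
  qed
  define N where "N = S - (\<Union>i\<in>C. cball (fst i) (snd i))"
  have "negligible (f ` N)"
  proof (rule negligible_locally_Lipschitz_image)
    show "\<exists>T B. open T \<and> x \<in> T \<and> (\<forall>y\<in>N \<inter> T. norm (f y - f x) \<le> B * norm (y - x))" if "x \<in> N" for x
      using that pos lip
      by (intro exI[of _ "ball x d"] exI[of _ L]) (auto simp: N_def dist_norm norm_minus_commute)
  qed (use C in \<open>auto simp: N_def\<close>)
  then have fN: "f ` N \<in> lmeasurable" "measure lebesgue (f ` N) = 0"
    by (simp_all add: negligible_imp_measurable negligible_imp_measure0)
  let ?U = "\<Union>i\<in>C. cball (f (fst i)) (L * snd i)"
  \<comment> \<open>Disjointness inside \<open>T\<close> gives every finite subfamily the same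
    bound, which then passes to the countable union.\<close>
  have bound: "measure lebesgue (\<Union>i\<in>I. cball (f (fst i)) (L * snd i)) \<le> L ^ n * measure lebesgue T"
    if I: "I \<subseteq> C" "finite I" for I
  proof -
    have "cball (fst i) (snd i) \<subseteq> T" if "i \<in> I" for i
    proof -
      have "i \<in> K" using that I C(2) by blast
      then show ?thesis by (simp add: K_def case_prod_beta)
    qed
    then have sub: "(\<Union>i\<in>I. cball (fst i) (snd i)) \<subseteq> T" by blast
    have rpos: "0 < snd i" if "i \<in> I" for i using that I C by (auto simp: K_def)
    have "measure lebesgue (\<Union>i\<in>I. cball (f (fst i)) (L * snd i))
        \<le> (\<Sum>i\<in>I. measure lebesgue (cball (f (fst i)) (L * snd i)))"
      by (rule measure_UNION_le) (use I in auto)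
    also have "\<dots> = (\<Sum>i\<in>I. L ^ n * measure lebesgue (cball (fst i) (snd i)))"
      using rpos pos by (intro sum.cong) (auto simp: content_cball n_def power_mult_distrib less_imp_le)
    also have "\<dots> = L ^ n * measure lebesgue (\<Union>i\<in>I. cball (fst i) (snd i))"
      using I pairwise_subset[OF C(3) I(1)] by (subst measure_UNION') (auto simp: sum_distrib_left)
    also have "\<dots> \<le> L ^ n * measure lebesgue T"
      using pos I sub by (intro mult_left_mono measure_mono_fmeasurable Tm)
        (auto intro!: fmeasurableD fmeasurable.finite_UN)
    finally show ?thesis .
  qed
  have Um: "?U \<in> lmeasurable" "measure lebesgue ?U \<le> L ^ n * measure lebesgue T"
    using fmeasurable_UN_bound[of C "\<lambda>i. cball (f (fst i)) (L * snd i)" lebesgue "L ^ n * measure lebesgue T"]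
      measure_UN_bound[of C "\<lambda>i. cball (f (fst i)) (L * snd i)" lebesgue "L ^ n * measure lebesgue T"]
      C(1) bound by auto
  have "B \<subseteq> ?U \<union> f ` N"
  proof
    fix y assume "y \<in> B"
    then obtain z where z: "z \<in> S" "y = f z" using B by auto
    show "y \<in> ?U \<union> f ` N"
    proof (cases "z \<in> N")
      case False
      then obtain i where i: "i \<in> C" "z \<in> cball (fst i) (snd i)" using z by (auto simp: N_def)
      then have "norm (f (fst i) - f z) \<le> L * norm (fst i - z)"
        using z C(2) by (intro lip) (auto simp: K_def dist_norm)
      also have "\<dots> \<le> L * snd i" using i pos by (simp add: dist_norm)
      finally have "y \<in> cball (f (fst i)) (L * snd i)" using z by (simp add: dist_norm)
      with i show ?thesis by blast
    qed (use z in simp)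
  qed
  then have "measure lebesgue B \<le> measure lebesgue (?U \<union> f ` N)"
    using B Um fN by (intro measure_mono_fmeasurable) auto
  also have "\<dots> \<le> measure lebesgue ?U + measure lebesgue (f ` N)"
    using Um fN by (intro measure_Un_le) auto
  also have "\<dots> \<le> L ^ n * measure lebesgue T" using Um fN by simp
  also have "\<dots> \<le> L ^ n * (measure lebesgue E + \<epsilon> / L ^ n)" using mT pos by (intro mult_left_mono) auto
  also have "\<dots> = L ^ DIM('a) * measure lebesgue E + \<epsilon>" using pos by (simp add: algebra_simps n_def)
  finally show "measure lebesgue B \<le> L ^ DIM('a) * measure lebesgue E + \<epsilon>" .
qed

text \<open>\<open>B\<close> is covered by the image of a slope map on good points of
  \<open>E\<close>, which is locally Lipschitz with every constant above
  \<open>(1 + \<kappa>) a\<close>, where \<open>\<kappa> = (n - 1) Lam / lam\<close>; letting the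
  constant decrease to this value gives the sharp factor.\<close>

lemma measure_lower_grad_image_le:
  fixes u :: "real^'n \<Rightarrow> real"
  assumes lam: "0 < lam" "lam \<le> Lam" and u: "continuous_on \<Omega> u" "visc_pucci_minus_le_0 lam Lam \<Omega> u"
    and E: "E \<in> lmeasurable" "0 < R" "\<And>z. z \<in> E \<Longrightarrow> cball z R \<subseteq> \<Omega>" and "0 < a"
    and B: "B \<in> sets lebesgue" "bounded B" "\<And>q. q \<in> B \<Longrightarrow> \<exists>z\<in>E. lower_grad a u \<Omega> z q"
  shows "measure lebesgue B
    \<le> ((1 + (real CARD('n) - 1) * Lam / lam) * a) ^ CARD('n) * measure lebesgue E"
proof -
  define P where "P = (real CARD('n) - 1) * Lam"
  have "0 \<le> P" using lam by (simp add: P_def Suc_leI)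
  let ?k0 = "(1 + P / lam) * a"
  have bound: "measure lebesgue B \<le> k ^ CARD('n) * measure lebesgue E" if "?k0 < k" for k
  proof -
    have gap: "0 < (k - a) * lam - a * P"
    proof -
      have "?k0 * lam = a * lam + a * P" using lam(1) by (simp add: field_simps)
      with mult_strict_right_mono[OF that lam(1)] show ?thesis by (simp add: algebra_simps)
    qed
    have "0 < k" using that \<open>0 < a\<close> \<open>0 \<le> P\<close> lam by (smt (verit) divide_nonneg_pos mult_pos_pos)
    \<comment> \<open>Chosen so that \<open>\<delta> * P\<close> is less than the gap left by
      \<open>k\<close>; the \<open>+ 1\<close> avoids a division by zero when
      \<open>P = 0\<close>.\<close>
    define \<delta> where "\<delta> = ((k - a) * lam - a * P) / (P + 1)"
    have "0 < \<delta>" using gap \<open>0 \<le> P\<close> by (simp add: \<delta>_def)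
    have "\<delta> * P < \<delta> * (P + 1)" using \<open>0 < \<delta>\<close> by simp
    also have "\<dots> = (k - a) * lam - a * P" using \<open>0 \<le> P\<close> by (simp add: \<delta>_def)
    finally have k: "(a + \<delta>) * (real CARD('n) - 1) * Lam < (k - a) * lam"
      by (simp add: P_def algebra_simps)
    have lip: "norm (q1 - q2) \<le> k * norm (x1 - x2)"
      if "x1 \<in> E" "x2 \<in> E" "lower_grad a u \<Omega> x1 q1" "lower_grad a u \<Omega> x2 q2"
        "2 * norm (x1 - x2) < R" "norm (q1 - q2) * norm (x1 - x2) \<le> \<delta> * R\<^sup>2" for x1 x2 q1 q2
      using lower_grad_lipschitz[OF lam u that(3,4) E(2) E(3) E(3) _ \<open>0 < \<delta>\<close> k that(5,6)] that \<open>0 < a\<close>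
      by simp
    define S where "S = {z\<in>E. \<exists>q\<in>B. lower_grad a u \<Omega> z q}"
    define f where "f = (\<lambda>z. SOME q. q \<in> B \<and> lower_grad a u \<Omega> z q)"
    have f: "f z \<in> B" "lower_grad a u \<Omega> z (f z)" "z \<in> E" if "z \<in> S" for z
    proof -
      have "\<exists>q. q \<in> B \<and> lower_grad a u \<Omega> z q" using that by (auto simp: S_def)
      from someI_ex[OF this] show "f z \<in> B" "lower_grad a u \<Omega> z (f z)" unfolding f_def by auto
    qed (use that in \<open>simp add: S_def\<close>)
    obtain M where M: "0 < M" "\<And>q. q \<in> B \<Longrightarrow> norm q \<le> M" using B(2) bounded_pos by metis
    \<comment> \<open>Slopes in \<open>B\<close> differ by at most \<open>2 M\<close>, so distances
      below \<open>d\<close> meet both smallness hypotheses of the Lipschitz estimate.\<close>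
    define d where "d = min (R / 2) (\<delta> * R\<^sup>2 / (2 * M))"
    have "0 < d" using E(2) \<open>0 < \<delta>\<close> M(1) by (simp add: d_def)
    have "B \<subseteq> f ` S"
    proof
      fix q assume "q \<in> B"
      then obtain z where z: "z \<in> E" "lower_grad a u \<Omega> z q" using B(3) by blast
      then have "z \<in> S" using \<open>q \<in> B\<close> by (auto simp: S_def)
      \<comment> \<open>With both points equal, the estimate says that the slope at \<open>z\<close>
        is unique, so the chosen one is \<open>q\<close>.\<close>
      then have "norm (f z - q) \<le> k * norm (z - z)"
        using f z E(2) \<open>0 < \<delta>\<close> by (intro lip) auto
      then show "q \<in> f ` S" using \<open>z \<in> S\<close> by auto
    qed
    moreover have "norm (f x - f y) \<le> k * norm (x - y)" if "x \<in> S" "y \<in> S" "norm (x - y) < d" for x y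
    proof (rule lip)
      have "norm (f x - f y) \<le> 2 * M"
        using norm_triangle_ineq4[of "f x" "f y"] M(2)[OF f(1)[OF that(1)]] M(2)[OF f(1)[OF that(2)]] by simp
      then have "norm (f x - f y) * norm (x - y) \<le> 2 * M * (\<delta> * R\<^sup>2 / (2 * M))"
        using that M(1) by (intro mult_mono) (auto simp: d_def)
      then show "norm (f x - f y) * norm (x - y) \<le> \<delta> * R\<^sup>2" using M(1) by simp
    qed (use f that in \<open>auto simp: d_def\<close>)
    ultimately show ?thesis
      using measure_le_locally_Lipschitz_image[OF E(1) _ \<open>0 < k\<close> \<open>0 < d\<close> _ B(1), of S f]
      by (auto simp: S_def)
  qed
  have "measure lebesgue B \<le> ?k0 ^ CARD('n) * measure lebesgue E"
  proof (rule tendsto_lowerbound)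
    show "((\<lambda>k. k ^ CARD('n) * measure lebesgue E) \<longlongrightarrow> ?k0 ^ CARD('n) * measure lebesgue E) (at_right ?k0)"
      by (intro tendsto_intros)
    show "\<forall>\<^sub>F k in at_right ?k0. measure lebesgue B \<le> k ^ CARD('n) * measure lebesgue E"
      using bound by (intro eventually_mono[OF eventually_at_right_less])
  qed simp
  then show ?thesis by (simp add: P_def)
qed

section \<open>Monotonicity and closedness of the good set\<close>

lemma half_square_expand:
  fixes x z :: "'a::real_inner"
  shows "c / 2 * (z \<bullet> z) = c / 2 * (x \<bullet> x) + c * (x \<bullet> (z - x)) + c / 2 * (norm (z - x))\<^sup>2"
  by (simp add: power2_norm_eq_inner inner_simps inner_commute algebra_simps)

text \<open>Completing the square matches the two slopes by \<open>q = p + a x\<close>.\<close>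

lemma G_minus_iff_lower_grad: "x \<in> G_minus a u \<Omega> \<longleftrightarrow> (\<exists>q. lower_grad a u \<Omega> x q)"
proof -
  have "(u x + p \<bullet> (z - x) - a / 2 * (norm (z - x))\<^sup>2 \<le> u z) \<longleftrightarrow>
      u x + a / 2 * (x \<bullet> x) + (p + a *\<^sub>R x) \<bullet> (z - x) \<le> u z + a / 2 * (z \<bullet> z)" for p z
    unfolding half_square_expand[of a z x] inner_add_left by auto
  then have "x \<in> G_minus a u \<Omega> \<longleftrightarrow> (\<exists>p. lower_grad a u \<Omega> x (p + a *\<^sub>R x))"
    by (auto simp: G_minus_def lower_grad_def)
  also have "\<dots> \<longleftrightarrow> (\<exists>q. lower_grad a u \<Omega> x q)"
    by (metis diff_add_cancel)
  finally show ?thesis .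
qed

text \<open>The added term \<open>(b - a)/2 |z|^2\<close> is convex with gradient
  \<open>(b - a) x\<close> at \<open>x\<close>. The explicit slope matters later, when it is
  compared with another slope at the same point.\<close>

lemma lower_grad_mono:
  assumes "lower_grad a u \<Omega> x q" "a \<le> b"
  shows "lower_grad b u \<Omega> x (q + (b - a) *\<^sub>R x)"
  unfolding lower_grad_def
proof (intro conjI ballI)
  fix z assume "z \<in> \<Omega>"
  have "0 \<le> (b - a) / 2 * (norm (z - x))\<^sup>2" using assms by simp
  then have "(b - a) / 2 * (x \<bullet> x) + (b - a) * (x \<bullet> (z - x)) \<le> (b - a) / 2 * (z \<bullet> z)"
    using half_square_expand[of "b - a" z x] by linarith
  moreover have "u x + a / 2 * (x \<bullet> x) + q \<bullet> (z - x) \<le> u z + a / 2 * (z \<bullet> z)"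
    using assms \<open>z \<in> \<Omega>\<close> by (simp add: lower_grad_def)
  moreover have "b / 2 * c = a / 2 * c + (b - a) / 2 * c" for c :: real
    by (simp add: diff_divide_distrib left_diff_distrib)
  ultimately show "u x + b / 2 * (x \<bullet> x) + (q + (b - a) *\<^sub>R x) \<bullet> (z - x) \<le> u z + b / 2 * (z \<bullet> z)"
    unfolding inner_add_left inner_scaleR_left by (smt (verit))
qed (use assms in \<open>simp add: lower_grad_def\<close>)

lemma G_minus_mono: "a \<le> b \<Longrightarrow> G_minus a u \<Omega> \<subseteq> G_minus b u \<Omega>"
  using lower_grad_mono by (auto simp: G_minus_iff_lower_grad) blast

lemma A_minus_antimono: "a \<le> b \<Longrightarrow> A_minus b u \<Omega> \<subseteq> A_minus a u \<Omega>"
  using G_minus_mono by (auto simp: A_minus_def) blast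

text \<open>A limit in \<open>\<Omega>\<close> of good points is good: boundedness of
  \<open>u\<close> bounds their slopes, a subsequence of slopes converges, and the support
  inequality passes to the limit.\<close>

lemma open_A_minus:
  fixes u :: "real^'n \<Rightarrow> real"
  assumes "open \<Omega>" and u: "continuous_on \<Omega> u" and bdd: "\<And>x. x \<in> \<Omega> \<Longrightarrow> \<bar>u x\<bar> \<le> S" and "0 \<le> a" "bounded \<Omega>"
  shows "open (A_minus a u \<Omega>)"
  unfolding open_contains_ball
proof (rule ccontr)
  let ?v = "\<lambda>z. u z + a / 2 * (z \<bullet> z)"
  assume "\<not> (\<forall>x\<in>A_minus a u \<Omega>. \<exists>e>0. ball x e \<subseteq> A_minus a u \<Omega>)"
  then obtain x where x: "x \<in> A_minus a u \<Omega>" and no: "\<And>e. 0 < e \<Longrightarrow> \<not> ball x e \<subseteq> A_minus a u \<Omega>" by blast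
  have "x \<in> \<Omega>" using x by (simp add: A_minus_def)
  then obtain h where h: "0 < h" "ball x h \<subseteq> \<Omega>" using \<open>open \<Omega>\<close> open_contains_ball by blast
  have "\<exists>y q. dist x y < min (h / 2) (1 / real (Suc n)) \<and> lower_grad a u \<Omega> y q" for n
  proof -
    have "0 < min (h / 2) (1 / real (Suc n))" using h by simp
    from no[OF this] obtain y where y: "dist x y < min (h / 2) (1 / real (Suc n))" "y \<notin> A_minus a u \<Omega>"
      by (auto simp: subset_iff)
    moreover have "y \<in> \<Omega>" using y h by auto
    ultimately show ?thesis by (auto simp: A_minus_def G_minus_iff_lower_grad)
  qed
  then obtain y q where y: "\<And>n. dist x (y n) < min (h / 2) (1 / real (Suc n))"
    and q: "\<And>n. lower_grad a u \<Omega> (y n) (q n)" by metis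
  obtain b where b: "0 < b" "\<And>z. z \<in> \<Omega> \<Longrightarrow> norm z \<le> b" using \<open>bounded \<Omega>\<close> bounded_pos by metis
  define M where "M = S + a / 2 * b\<^sup>2"
  have vM: "\<bar>?v z\<bar> \<le> M" if "z \<in> \<Omega>" for z
  proof -
    have "z \<bullet> z \<le> b\<^sup>2" using b that by (metis norm_ge_zero power2_norm_eq_inner power_mono)
    then have "a / 2 * (z \<bullet> z) \<le> a / 2 * b\<^sup>2" "0 \<le> a / 2 * (z \<bullet> z)"
      using \<open>0 \<le> a\<close> by (auto intro: mult_left_mono)
    with bdd[OF that] show ?thesis by (simp add: M_def)
  qed
  have "norm (q n) \<le> 4 * M / h" for n
  proof (cases "q n = 0")
    case True
    then show ?thesis using vM[OF \<open>x \<in> \<Omega>\<close>] h by simp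
  next
    case False
    \<comment> \<open>Testing the support inequality at distance \<open>h / 2\<close> in the
      direction of the slope bounds its norm by the oscillation of \<open>?v\<close>;
      \<open>w\<close> stays in \<open>ball x h\<close>.\<close>
    define w where "w = y n + (h / 2 / norm (q n)) *\<^sub>R q n"
    have "dist x w \<le> dist x (y n) + h / 2"
      using dist_triangle[of x w "y n"] False h by (simp add: w_def dist_norm)
    then have "w \<in> \<Omega>" using y[of n] h by auto
    moreover have "y n \<in> \<Omega>" using q[of n] by (simp add: lower_grad_def)
    moreover have "?v (y n) + q n \<bullet> (w - y n) \<le> ?v w"
      using q[of n] \<open>w \<in> \<Omega>\<close> by (simp add: lower_grad_def)
    moreover have "q n \<bullet> (w - y n) = h / 2 * norm (q n)"
      using False by (simp add: w_def power2_norm_eq_inner[symmetric] power2_eq_square)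
    ultimately have "h / 2 * norm (q n) \<le> 2 * M" using vM[of w] vM[of "y n"] by linarith
    then show ?thesis using h by (simp add: field_simps)
  qed
  then have "\<forall>n. q n \<in> cball 0 (4 * M / h)" by simp
  then obtain p r where r: "strict_mono r" "(q \<circ> r) \<longlonglongrightarrow> p"
    using compact_cball[of "0 :: real^'n"] unfolding compact_def by meson
  have "y \<longlonglongrightarrow> x"
  proof (rule metric_LIMSEQ_I)
    fix e :: real assume "0 < e"
    then obtain N where N: "1 / real (Suc N) < e" using nat_approx_posE by blast
    have "dist (y n) x < e" if "N \<le> n" for n
    proof -
      have "1 / real (Suc n) \<le> 1 / real (Suc N)" using that by (simp add: frac_le)
      then show ?thesis using y[of n] N by (simp add: dist_commute)
    qed
    then show "\<exists>N. \<forall>n\<ge>N. dist (y n) x < e" by blast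
  qed
  then have yr: "(y \<circ> r) \<longlonglongrightarrow> x" using r LIMSEQ_subseq_LIMSEQ by blast
  have "isCont u x" using u \<open>open \<Omega>\<close> \<open>x \<in> \<Omega>\<close> continuous_on_eq_continuous_at by blast
  then have ur: "(\<lambda>n. u ((y \<circ> r) n)) \<longlonglongrightarrow> u x" using yr isCont_tendsto_compose by blast
  have "lower_grad a u \<Omega> x p"
    unfolding lower_grad_def
  proof (intro conjI ballI \<open>x \<in> \<Omega>\<close>)
    fix z assume z: "z \<in> \<Omega>"
    show "u x + a / 2 * (x \<bullet> x) + p \<bullet> (z - x) \<le> ?v z"
    proof (rule LIMSEQ_le_const2)
      show "(\<lambda>n. u ((y \<circ> r) n) + a / 2 * ((y \<circ> r) n \<bullet> (y \<circ> r) n) + (q \<circ> r) n \<bullet> (z - (y \<circ> r) n))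
          \<longlonglongrightarrow> u x + a / 2 * (x \<bullet> x) + p \<bullet> (z - x)"
        by (intro tendsto_intros ur yr r)
      show "\<exists>N. \<forall>n\<ge>N. u ((y \<circ> r) n) + a / 2 * ((y \<circ> r) n \<bullet> (y \<circ> r) n) + (q \<circ> r) n \<bullet> (z - (y \<circ> r) n) \<le> ?v z"
        using q z by (auto simp: lower_grad_def)
    qed
  qed
  then show False using x by (auto simp: A_minus_def G_minus_iff_lower_grad)
qed

section \<open>New good points\<close>

lemma lower_grad_unique:
  fixes u :: "real^'n \<Rightarrow> real"
  assumes lam: "0 < lam" "lam \<le> Lam" and u: "continuous_on \<Omega> u" "visc_pucci_minus_le_0 lam Lam \<Omega> u"
    and "lower_grad a u \<Omega> x q1" "lower_grad a u \<Omega> x q2" and "open \<Omega>" "0 \<le> a"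
  shows "q1 = q2"
proof -
  have "x \<in> \<Omega>" using assms by (simp add: lower_grad_def)
  then obtain R where R: "0 < R" "cball x R \<subseteq> \<Omega>" using \<open>open \<Omega>\<close> open_contains_cball by blast
  \<comment> \<open>The final \<open>+ 1\<close> makes the required inequality strict for
    \<open>\<delta> = 1\<close>.\<close>
  define k where "k = a + ((a + 1) * (real CARD('n) - 1) * Lam + 1) / lam"
  have "norm (q1 - q2) \<le> k * norm (x - x)"
    by (rule lower_grad_lipschitz[OF lam u assms(5,6) R R(2) \<open>0 \<le> a\<close>, of 1])
      (use R lam in \<open>auto simp: k_def\<close>)
  then show ?thesis by simp
qed

text \<open>Minimise \<open>u\<close> plus a paraboloid of opening \<open>t\<close> with vertex
  \<open>x\<close>. Outside the ball the paraboloid is at least \<open>2 S\<close>, the largest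
  possible oscillation of \<open>u\<close>, so the minimum over the ball is global.\<close>

lemma exists_good_point_near:
  fixes u :: "real^'n \<Rightarrow> real"
  assumes u: "continuous_on \<Omega> u" "\<And>z. z \<in> \<Omega> \<Longrightarrow> \<bar>u z\<bar> \<le> S" and "cball x \<rho> \<subseteq> \<Omega>" "0 \<le> \<rho>" "0 \<le> t" "4 * S \<le> t * \<rho>\<^sup>2"
  shows "\<exists>z\<in>cball x \<rho>. z \<in> G_minus t u \<Omega>"
proof -
  let ?W = "\<lambda>z. u z + t / 2 * (norm (z - x))\<^sup>2"
  have contW: "continuous_on (cball x \<rho>) ?W"
    by (intro continuous_intros continuous_on_subset[OF u(1) assms(3)])
  have xc: "x \<in> cball x \<rho>" using \<open>0 \<le> \<rho>\<close> by simp
  from continuous_attains_inf[OF compact_cball _ contW] xc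
  obtain z where z: "z \<in> cball x \<rho>" "\<And>w. w \<in> cball x \<rho> \<Longrightarrow> ?W z \<le> ?W w"
    by blast
  have min: "?W z \<le> ?W w" if "w \<in> \<Omega>" for w
  proof (cases "w \<in> cball x \<rho>")
    case False
    then have "\<rho> \<le> norm (w - x)" by (simp add: dist_norm norm_minus_commute)
    then have "\<rho>\<^sup>2 \<le> (norm (w - x))\<^sup>2" using \<open>0 \<le> \<rho>\<close> by (intro power_mono)
    then have "t * \<rho>\<^sup>2 \<le> t * (norm (w - x))\<^sup>2" using \<open>0 \<le> t\<close> by (intro mult_left_mono)
    moreover have "x \<in> \<Omega>" using xc assms(3) by blast
    ultimately show ?thesis using z(2)[OF xc] u(2)[OF that] u(2)[of x] assms(6) by simp
  qed (use z in simp)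
  have "lower_grad t u \<Omega> z (t *\<^sub>R x)"
    unfolding lower_grad_def
  proof (intro conjI ballI)
    fix w assume "w \<in> \<Omega>"
    from min[OF this] half_square_expand[of t w x] half_square_expand[of t z x]
    show "u z + t / 2 * (z \<bullet> z) + (t *\<^sub>R x) \<bullet> (w - z) \<le> u w + t / 2 * (w \<bullet> w)"
      by (simp add: inner_diff_right algebra_simps)
  qed (use z assms in auto)
  then show ?thesis using z by (auto simp: G_minus_iff_lower_grad)
qed

text \<open>
  \<open>lower_grad_lipschitz\<close> is applied at the macroscopic scale \<open>r\<close>; its smallness hypothesis holds with
  \<open>\<delta> = t/2\<close> because \<open>r\<close> is small compared with the distance \<open>R\<close> to the boundary.
\<close>

lemma measure_new_good_points_ge:
  fixes u :: "real^'n \<Rightarrow> real"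
  assumes \<kappa>_def: "\<kappa> = (real CARD('n) - 1) * Lam / lam" and lam: "0 < lam" "lam \<le> Lam" and u: "continuous_on \<Omega> u" "visc_pucci_minus_le_0 lam Lam \<Omega> u"
    and "open \<Omega>" and pos: "0 < t" "0 < r" and K: "8 * (1 + \<kappa>) \<le> K"
    and R: "\<And>z. z \<in> cball x (2 * r) \<Longrightarrow> cball z R \<subseteq> \<Omega>" "6 * r < R" "9 * K * r\<^sup>2 \<le> R\<^sup>2"
    and x0: "x0 \<in> cball x r \<inter> G_minus t u \<Omega>" and none: "ball x r \<inter> G_minus t u \<Omega> = {}"
    and E: "E = G_minus ((K + 1) * t) u \<Omega> \<inter> A_minus t u \<Omega> \<inter> ball x (2 * r)" "E \<in> lmeasurable"
  shows "measure lebesgue (ball x (K * t * r / 2))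
    \<le> ((1 + \<kappa>) * ((K + 1) * t)) ^ CARD('n) * measure lebesgue E"
proof -
  have "0 < R" using R pos by simp
  have "0 \<le> \<kappa>" using lam by (simp add: \<kappa>_def Suc_leI)
  then have "0 < K" using K by simp
  obtain q0 where q0: "lower_grad t u \<Omega> x0 q0" using x0 by (auto simp: G_minus_iff_lower_grad)
  have dx0: "norm (x0 - x) \<le> r" using x0 by (simp add: dist_norm norm_minus_commute)
  have sub: "cball x (2 * r) \<subseteq> \<Omega>" using R(1) \<open>0 < R\<close> by (metis centre_in_cball less_eq_real_def subset_iff)
  let ?a = "(K + 1) * t"
  have ex: "\<exists>z\<in>E. lower_grad ?a u \<Omega> z q" if q: "q \<in> ball (q0 + (K * t) *\<^sub>R x) (K * t * r / 2)" for q
  proof -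
    \<comment> \<open>\<open>y\<close> is the vertex of the added paraboloid; it runs through
      \<open>ball x (r / 2)\<close> as \<open>q\<close> runs through the ball of slopes.\<close>
    define y where "y = (1 / (K * t)) *\<^sub>R (q - q0)"
    have qy: "q = q0 + (K * t) *\<^sub>R y" using pos \<open>0 < K\<close> by (simp add: y_def)
    have "norm ((K * t) *\<^sub>R (x - y)) < K * t * r / 2"
      using q unfolding qy by (simp add: dist_norm scaleR_diff_right)
    then have yx: "norm (y - x) < r / 2" using pos \<open>0 < K\<close> by (simp add: norm_minus_commute)
    \<comment> \<open>Beyond this distance from \<open>y\<close> the added paraboloid exceeds its
      value at \<open>x0\<close>, where \<open>?g\<close> is minimal, so the minimum of the sum lies
      in \<open>cball y ?\<rho>\<close>.\<close>
    let ?\<rho> = "norm (x0 - y)"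
    have \<rho>: "?\<rho> < 3 / 2 * r" using norm_triangle_ineq4[of "x0 - x" "y - x"] dx0 yx by simp
    have near: "norm (z - x) < 2 * r" if "z \<in> cball y ?\<rho>" for z
      using that \<rho> yx norm_triangle_ineq[of "z - y" "y - x"] by (simp add: dist_norm norm_minus_commute)
    have sub\<rho>: "cball y ?\<rho> \<subseteq> \<Omega>" using near sub by (force simp: dist_norm norm_minus_commute)
    let ?g = "\<lambda>z. u z + t / 2 * (z \<bullet> z) - q0 \<bullet> z"
    have g: "?g x0 \<le> ?g z" if "z \<in> \<Omega>" for z
      using q0 that by (simp add: lower_grad_def inner_diff_right algebra_simps)
    let ?W = "\<lambda>z. ?g z + K * t / 2 * (norm (z - y))\<^sup>2"
    have contW: "continuous_on (cball y ?\<rho>) ?W"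
      by (intro continuous_intros continuous_on_subset[OF u(1) sub\<rho>])
    have x0c: "x0 \<in> cball y ?\<rho>" by (simp add: dist_norm norm_minus_commute)
    from continuous_attains_inf[OF compact_cball _ contW] x0c
    obtain z where z: "z \<in> cball y ?\<rho>" "\<And>w. w \<in> cball y ?\<rho> \<Longrightarrow> ?W z \<le> ?W w"
      by blast
    have min: "?W z \<le> ?W w" if "w \<in> \<Omega>" for w
    proof (cases "w \<in> cball y ?\<rho>")
      case False
      then have "?\<rho> \<le> norm (w - y)" by (simp add: dist_norm norm_minus_commute)
      then have "K * t / 2 * ?\<rho>\<^sup>2 \<le> K * t / 2 * (norm (w - y))\<^sup>2"
        using pos \<open>0 < K\<close> by (intro mult_left_mono power_mono) auto
      then show ?thesis using z(2)[OF x0c] g[OF that] by linarith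
    qed (use z in simp)
    have zq: "lower_grad ?a u \<Omega> z q"
      unfolding lower_grad_def
    proof (intro conjI ballI)
      fix w assume "w \<in> \<Omega>"
      have split: "?a / 2 * c = t / 2 * c + K * t / 2 * c" for c :: real by (simp add: field_simps)
      from min[OF \<open>w \<in> \<Omega>\<close>] half_square_expand[of "K * t" w y] half_square_expand[of "K * t" z y]
      show "u z + ?a / 2 * (z \<bullet> z) + q \<bullet> (w - z) \<le> u w + ?a / 2 * (w \<bullet> w)"
        unfolding qy split by (simp add: inner_diff_right inner_add_left algebra_simps)
    qed (use z sub\<rho> in auto)
    have "z \<notin> G_minus t u \<Omega>"
    proof
      assume zG: "z \<in> G_minus t u \<Omega>"
      then obtain q2 where q2: "lower_grad t u \<Omega> z q2" by (auto simp: G_minus_iff_lower_grad)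
      have "t \<le> ?a" using pos \<open>0 < K\<close> by (simp add: field_simps)
      from lower_grad_mono[OF q2 this] have "lower_grad ?a u \<Omega> z (q2 + (?a - t) *\<^sub>R z)" .
      \<comment> \<open>Two slopes at \<open>z\<close> for the opening \<open>?a\<close> must agree,
        which determines the slope for \<open>t\<close> in terms of \<open>z - y\<close>.\<close>
      with zq have "q = q2 + (?a - t) *\<^sub>R z"
        using lower_grad_unique[OF lam u] \<open>open \<Omega>\<close> pos \<open>0 < K\<close> by (metis \<open>t \<le> ?a\<close> less_eq_real_def order_trans)
      then have "q0 - q2 = (K * t) *\<^sub>R (z - y)" unfolding qy by (simp add: algebra_simps)
      then have s: "norm (q0 - q2) = K * t * norm (z - y)" using pos \<open>0 < K\<close> by simp
      have zy: "norm (z - y) \<le> ?\<rho>" using z by (simp add: dist_norm norm_minus_commute)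
      \<comment> \<open>A point good for \<open>t\<close> avoids \<open>ball x r\<close>, so
        \<open>norm (z - y) > r / 2\<close> and \<open>?\<rho> < 3 * norm (z - y)\<close>. Hence
        \<open>norm (x0 - z) < 4 * norm (z - y)\<close>, the source of the \<open>8\<close> in the
        hypothesis on \<open>K\<close>.\<close>
      have "r \<le> norm (z - x)"
        using none zG by (force simp: dist_norm norm_minus_commute)
      then have far: "r / 2 < norm (z - y)"
        using norm_triangle_ineq[of "z - y" "y - x"] yx by simp
      have d: "norm (x0 - z) \<le> ?\<rho> + norm (z - y)"
        using norm_triangle_ineq4[of "x0 - y" "z - y"] by simp
      have d3: "norm (x0 - z) \<le> 3 * r" using d zy \<rho> by linarith
      have "norm (q0 - q2) \<le> 2 * t * (1 + \<kappa>) * norm (x0 - z)"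
      proof (rule lower_grad_lipschitz[OF lam u q0 q2 \<open>0 < R\<close>])
        show "cball x0 R \<subseteq> \<Omega>" using dx0 pos by (intro R) (simp add: dist_norm norm_minus_commute)
        show "cball z R \<subseteq> \<Omega>" using near[OF z(1)] by (intro R) (simp add: dist_norm norm_minus_commute)
        define P where "P = (real CARD('n) - 1) * Lam"
        have "P = lam * \<kappa>" using lam by (simp add: \<kappa>_def P_def)
        then have 1: "(2 * t * (1 + \<kappa>) - t) * lam = t * lam + 2 * (t * P)"
          by (simp add: algebra_simps)
        have 2: "(t + t / 2) * (real CARD('n) - 1) * Lam = 3 / 2 * (t * P)"
          unfolding P_def by (simp add: field_simps)
        have "0 \<le> P" "0 < t * lam" using lam pos by (simp_all add: P_def Suc_leI)
        then have "0 \<le> t * P" using pos by simp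
        with 1 2 \<open>0 < t * lam\<close> show "(t + t / 2) * (real CARD('n) - 1) * Lam < (2 * t * (1 + \<kappa>) - t) * lam"
          by linarith
        show "2 * norm (x0 - z) < R" using d3 R by simp
        have "norm (q0 - q2) * norm (x0 - z) \<le> (K * t * (3 / 2 * r)) * (3 * r)"
          unfolding s using d3 zy \<rho> pos \<open>0 < K\<close> by (intro mult_mono) auto
        also have "\<dots> = t / 2 * (9 * K * r\<^sup>2)" by (simp add: power2_eq_square)
        also have "\<dots> \<le> t / 2 * R\<^sup>2" using R pos by (intro mult_left_mono) auto
        finally show "norm (q0 - q2) * norm (x0 - z) \<le> t / 2 * R\<^sup>2" .
      qed (use pos in auto)
      also have "\<dots> < 2 * t * (1 + \<kappa>) * (4 * norm (z - y))"
        using d \<rho> far pos \<open>0 \<le> \<kappa>\<close> by (intro mult_strict_left_mono) auto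
      also have "\<dots> = 8 * (1 + \<kappa>) * (t * norm (z - y))" by (simp add: algebra_simps)
      also have "\<dots> \<le> K * (t * norm (z - y))" using K pos by (intro mult_right_mono) auto
      finally show False using s by simp
    qed
    moreover have "z \<in> ball x (2 * r)" using near[OF z(1)] by (simp add: dist_norm norm_minus_commute)
    moreover have "z \<in> G_minus ?a u \<Omega>" using zq G_minus_iff_lower_grad by blast
    moreover have "z \<in> \<Omega>" using zq by (simp add: lower_grad_def)
    ultimately show ?thesis using zq by (intro bexI[of _ z]) (auto simp: E(1) A_minus_def)
  qed
  have "measure lebesgue (ball (q0 + (K * t) *\<^sub>R x) (K * t * r / 2))
      \<le> ((1 + \<kappa>) * ?a) ^ CARD('n) * measure lebesgue E"
    unfolding \<kappa>_def
  proof (rule measure_lower_grad_image_le[OF lam u E(2) \<open>0 < R\<close>])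
    show "cball z R \<subseteq> \<Omega>" if "z \<in> E" for z
      using that E(1) by (intro R) auto
    show "0 < ?a" using pos \<open>0 < K\<close> by simp
  qed (use ex in auto)
  then show ?thesis using pos \<open>0 < K\<close> by (simp add: content_ball)
qed

section \<open>Covering by balls and one step of the decay\<close>

text \<open>Greedy selection: keep a ball of largest radius, discard all balls meeting it, and
  recurse on the rest.\<close>

lemma finite_disjoint_balls:
  fixes r :: "'a::metric_space \<Rightarrow> real"
  assumes "finite F" "\<And>x. x \<in> F \<Longrightarrow> 0 < r x"
  shows "\<exists>C\<subseteq>F. pairwise (\<lambda>x y. disjnt (ball x (r x)) (ball y (r y))) C \<and>
    (\<forall>x\<in>F. \<exists>y\<in>C. r x \<le> r y \<and> \<not> disjnt (ball x (r x)) (ball y (r y)))"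
  using assms
proof (induction F rule: finite_psubset_induct)
  case (psubset F)
  show ?case
  proof (cases "F = {}")
    case False
    then have "Max (r ` F) \<in> r ` F" using psubset.hyps by simp
    then obtain y where y: "y \<in> F" "r y = Max (r ` F)" by auto
    then have max: "r x \<le> r y" if "x \<in> F" for x using psubset.hyps that by simp
    let ?G = "{x\<in>F. disjnt (ball x (r x)) (ball y (r y))}"
    have self: "\<not> disjnt (ball x (r x)) (ball x (r x))" if "x \<in> F" for x
      using psubset.prems[OF that] by (auto simp: disjnt_def)
    then have "?G \<subset> F" using y(1) by blast
    then have "\<exists>C\<subseteq>?G. pairwise (\<lambda>x y. disjnt (ball x (r x)) (ball y (r y))) C \<and>
        (\<forall>x\<in>?G. \<exists>y\<in>C. r x \<le> r y \<and> \<not> disjnt (ball x (r x)) (ball y (r y)))"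
      by (rule psubset.IH) (use psubset.prems in auto)
    then obtain C where C: "C \<subseteq> ?G" "pairwise (\<lambda>x y. disjnt (ball x (r x)) (ball y (r y))) C"
      "\<And>x. x \<in> ?G \<Longrightarrow> \<exists>y\<in>C. r x \<le> r y \<and> \<not> disjnt (ball x (r x)) (ball y (r y))"
      by blast
    show ?thesis
    proof (intro exI[of _ "insert y C"] conjI)
      show "insert y C \<subseteq> F" using C(1) y(1) by blast
      show "pairwise (\<lambda>x y. disjnt (ball x (r x)) (ball y (r y))) (insert y C)"
        using C(1,2) by (auto simp: pairwise_insert disjnt_sym)
      show "\<forall>x\<in>F. \<exists>y\<in>insert y C. r x \<le> r y \<and> \<not> disjnt (ball x (r x)) (ball y (r y))"
        using C(3) max by blast
    qed
  qed simp
qed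

text \<open>Only the centres have to be covered, so the enlargement factor can be any number above
  \<open>2\<close>, not \<open>3\<close>.\<close>

lemma compact_cover_disjoint_balls:
  fixes r :: "'a::metric_space \<Rightarrow> real"
  assumes "compact Q" "\<And>x. x \<in> Q \<Longrightarrow> 0 < r x"
  obtains C where "finite C" "C \<subseteq> Q" "pairwise (\<lambda>x y. disjnt (ball x (r x)) (ball y (r y))) C"
    "Q \<subseteq> (\<Union>x\<in>C. ball x (9 / 4 * r x))"
proof -
  \<comment> \<open>A point within \<open>r x / 4\<close> of \<open>x\<close> is within
    \<open>r y + r x + r x / 4 \<le> 9/4 * r y\<close> of the centre \<open>y\<close> of a selected
    ball that is no smaller than the ball at \<open>x\<close> and meets it.\<close>
  have "Q \<subseteq> (\<Union>x\<in>Q. ball x (r x / 4))" using assms(2) by force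
  then obtain F where F: "F \<subseteq> Q" "finite F" "Q \<subseteq> (\<Union>x\<in>F. ball x (r x / 4))"
    using compactE_image[OF assms(1), of Q "\<lambda>x. ball x (r x / 4)"] by auto
  then obtain C where C: "C \<subseteq> F" "pairwise (\<lambda>x y. disjnt (ball x (r x)) (ball y (r y))) C"
    and meet: "\<And>x. x \<in> F \<Longrightarrow> \<exists>y\<in>C. r x \<le> r y \<and> \<not> disjnt (ball x (r x)) (ball y (r y))"
    using finite_disjoint_balls[OF F(2), of r] assms(2) F(1) by blast
  show ?thesis
  proof
    show "finite C" using C F finite_subset by blast
    show "C \<subseteq> Q" using C F by blast
    show "Q \<subseteq> (\<Union>x\<in>C. ball x (9 / 4 * r x))"
    proof
      fix z assume "z \<in> Q"
      then obtain x where x: "x \<in> F" "dist x z < r x / 4" using F by auto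
      then obtain y w where y: "y \<in> C" "r x \<le> r y" and w: "dist x w < r x" "dist y w < r y"
        using meet[OF x(1)] by (auto simp: disjnt_iff)
      have "dist y z \<le> dist y w + dist x w + dist x z" by metric
      then show "z \<in> (\<Union>x\<in>C. ball x (9 / 4 * r x))"
        using x w y by (intro UN_I[OF y(1)]) simp
    qed
  qed (fact C)
qed

text \<open>
  The points gained at \<open>x \<in> ball 0 \<rho>\<close> may lie outside \<open>ball 0 \<rho>\<close>. Therefore the balls are centred at points
  still bad for \<open>(K + 1) t\<close>, which yields the factor \<open>1 / (1 + \<mu>)\<close> instead of \<open>1 - \<mu>\<close>.
\<close>

lemma measure_A_minus_step:
  fixes u :: "real^'n \<Rightarrow> real"
  defines "\<Omega> \<equiv> ball 0 1"
  assumes lam: "0 < lam" "lam \<le> Lam" and u: "continuous_on \<Omega> u" "visc_pucci_minus_le_0 lam Lam \<Omega> u"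
    and S: "\<And>z. z \<in> \<Omega> \<Longrightarrow> \<bar>u z\<bar> \<le> S"
    and \<kappa>_def: "\<kappa> = (real CARD('n) - 1) * Lam / lam" and K: "8 * (1 + \<kappa>) \<le> K" and "0 < t"
    and \<delta>: "0 < \<delta>" "4 * S \<le> t * \<delta>\<^sup>2" "\<rho> + 2 * \<delta> \<le> 3 / 4" "6 * \<delta> < 1 / 8" "9 * K * \<delta>\<^sup>2 \<le> (1 / 8)\<^sup>2"
  shows "(1 + (K / ((K + 1) * (1 + \<kappa>) * 9)) ^ CARD('n)) * measure lebesgue (A_minus ((K + 1) * t) u \<Omega> \<inter> ball 0 \<rho>)
    \<le> measure lebesgue (A_minus t u \<Omega> \<inter> ball 0 (\<rho> + 2 * \<delta>))"
proof -
  let ?N = "(K + 1) * t"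
  let ?n = "CARD('n)"
  \<comment> \<open>The base is the ratio of the slope radius \<open>K t r / 2\<close>, divided by
    the Lipschitz constant \<open>(1 + \<kappa>) (K + 1) t\<close>, to the covering radius
    \<open>9/4 * (2 r)\<close>.\<close>
  define \<mu> where "\<mu> = (K / ((K + 1) * (1 + \<kappa>) * 9)) ^ ?n"
  have "0 \<le> \<kappa>" using lam by (simp add: \<kappa>_def Suc_leI)
  then have "0 < K" using K by simp
  have "0 < \<mu>" using \<open>0 < K\<close> \<open>0 \<le> \<kappa>\<close> by (simp add: \<mu>_def)
  have "0 < K * t" using \<open>0 < t\<close> \<open>0 < K\<close> by simp
  then have "t \<le> ?N" "0 < ?N" using \<open>0 < t\<close> by (simp_all add: distrib_right)
  have opA: "open (A_minus a u \<Omega>)" if "0 \<le> a" for a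
    by (rule open_A_minus[OF _ u(1) S that]) (auto simp: \<Omega>_def)
  have meas: "A_minus a u \<Omega> \<inter> ball 0 b \<in> lmeasurable" if "0 \<le> a" for a b
    using opA[OF that] by (intro lmeasurable_open open_Int) (auto intro: bounded_subset[OF bounded_ball])
  define E where "E = (\<lambda>x r. G_minus ?N u \<Omega> \<inter> A_minus t u \<Omega> \<inter> ball x (2 * r))"
  have E_eq: "E x r = (A_minus t u \<Omega> - A_minus ?N u \<Omega>) \<inter> ball x (2 * r)" for x r
    by (auto simp: E_def A_minus_def)
  have Em: "E x r \<in> lmeasurable" for x r
  proof -
    have "E x r = A_minus t u \<Omega> \<inter> ball x (2 * r) - A_minus ?N u \<Omega>" by (auto simp: E_eq)
    moreover have "A_minus t u \<Omega> \<inter> ball x (2 * r) \<in> lmeasurable"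
      using opA \<open>0 < t\<close> by (intro lmeasurable_open open_Int) (auto intro: bounded_subset[OF bounded_ball])
    moreover have "A_minus ?N u \<Omega> \<in> sets lebesgue"
      using opA[of ?N] \<open>0 < ?N\<close> by (simp add: borel_open sets_completionI_sets)
    ultimately show ?thesis by (simp add: fmeasurable.Diff fmeasurable_Diff)
  qed
  let ?W = "A_minus ?N u \<Omega> \<inter> ball 0 \<rho>"
  have "\<exists>r. 0 < r \<and> r \<le> \<delta> \<and> \<mu> * measure lebesgue (ball x (9 / 4 * (2 * r))) \<le> measure lebesgue (E x r)"
    if "x \<in> ?W" for x
  proof -
    have x: "norm x < \<rho>" "x \<in> A_minus t u \<Omega>" using that A_minus_antimono[OF \<open>t \<le> ?N\<close>] by auto
    have sub: "cball x \<delta> \<subseteq> \<Omega>"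
    proof
      fix z assume "z \<in> cball x \<delta>"
      then show "z \<in> \<Omega>"
        using norm_triangle_ineq[of x "z - x"] x \<delta> by (simp add: \<Omega>_def dist_norm norm_minus_commute)
    qed
    have "cball x \<delta> \<inter> G_minus t u \<Omega> = cball x \<delta> - A_minus t u \<Omega>" using sub by (auto simp: A_minus_def)
    then have "closed (cball x \<delta> \<inter> G_minus t u \<Omega>)" using opA[of t] \<open>0 < t\<close> by (simp add: closed_Diff)
    moreover have "cball x \<delta> \<inter> G_minus t u \<Omega> \<noteq> {}"
      using exists_good_point_near[OF u(1) S sub _ _ \<delta>(2)] \<delta> \<open>0 < t\<close> by auto
    \<comment> \<open>The good set is closed in \<open>cball x \<delta>\<close> and nonempty by the
      condition \<open>4 * S \<le> t * \<delta>^2\<close>, so a nearest good point exists.\<close>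
    ultimately obtain x0 where x0: "x0 \<in> cball x \<delta> \<inter> G_minus t u \<Omega>"
      and closest: "\<And>z. z \<in> cball x \<delta> \<inter> G_minus t u \<Omega> \<Longrightarrow> dist x x0 \<le> dist x z"
      by (metis distance_attains_inf)
    define r where "r = dist x x0"
    have "x \<noteq> x0" using x x0 by (auto simp: A_minus_def)
    then have r: "0 < r" "r \<le> \<delta>" using x0 by (auto simp: r_def)
    have bound: "measure lebesgue (ball x (K * t * r / 2))
        \<le> ((1 + \<kappa>) * ?N) ^ ?n * measure lebesgue (E x r)"
    proof (rule measure_new_good_points_ge[OF \<kappa>_def lam u _ \<open>0 < t\<close> r(1) K])
      show "open \<Omega>" by (simp add: \<Omega>_def)
      show "cball z (1 / 8) \<subseteq> \<Omega>" if "z \<in> cball x (2 * r)" for z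
      proof
        fix w assume "w \<in> cball z (1 / 8)"
        then show "w \<in> \<Omega>"
          using norm_triangle_ineq[of x "z - x"] norm_triangle_ineq[of z "w - z"] that x \<delta> r
          by (simp add: \<Omega>_def dist_norm norm_minus_commute)
      qed
      show "6 * r < 1 / 8" using r \<delta> by simp
      have "9 * K * r\<^sup>2 \<le> 9 * K * \<delta>\<^sup>2" using r \<open>0 < K\<close> by (intro mult_left_mono power_mono) auto
      then show "9 * K * r\<^sup>2 \<le> (1 / 8)\<^sup>2" using \<delta>(5) by simp
      show "x0 \<in> cball x r \<inter> G_minus t u \<Omega>" using x0 by (simp add: r_def)
      show "ball x r \<inter> G_minus t u \<Omega> = {}"
      proof (rule equals0I)
        fix z assume "z \<in> ball x r \<inter> G_minus t u \<Omega>"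
        then have "dist x z < r" "z \<in> G_minus t u \<Omega>" by auto
        then show False using closest[of z] r by (simp add: r_def)
      qed
    qed (use Em in \<open>auto simp: E_def\<close>)
    let ?V = "unit_ball_vol (real ?n)"
    have "\<mu> * measure lebesgue (ball x (9 / 4 * (2 * r))) = ?V * (K / ((K + 1) * (1 + \<kappa>) * 9) * (9 / 4 * (2 * r))) ^ ?n"
    proof -
      have "measure lebesgue (ball x (9 / 4 * (2 * r))) = ?V * (9 / 4 * (2 * r)) ^ ?n"
        using r content_ball[of "9 / 4 * (2 * r)" x] by simp
      then show ?thesis unfolding \<mu>_def power_mult_distrib by (simp only: mult_ac)
    qed
    also have "K / ((K + 1) * (1 + \<kappa>) * 9) * (9 / 4 * (2 * r)) = (K * t * r / 2) / ((1 + \<kappa>) * ?N)"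
    proof -
      define D where "D = (K + 1) * (1 + \<kappa>)"
      have "D \<noteq> 0" using \<open>0 < K\<close> \<open>0 \<le> \<kappa>\<close> by (simp add: D_def)
      moreover have "(1 + \<kappa>) * ?N = D * t" by (simp add: D_def)
      ultimately show ?thesis using \<open>0 < t\<close> unfolding D_def[symmetric] by (simp add: field_simps)
    qed
    also have "?V * ((K * t * r / 2) / ((1 + \<kappa>) * ?N)) ^ ?n
        = measure lebesgue (ball x (K * t * r / 2)) / ((1 + \<kappa>) * ?N) ^ ?n"
    proof -
      have "0 \<le> K * t * r / 2" using r \<open>0 < K\<close> \<open>0 < t\<close> by simp
      then have "measure lebesgue (ball x (K * t * r / 2)) = ?V * (K * t * r / 2) ^ ?n"
        using content_ball[of "K * t * r / 2" x] by simp
      then show ?thesis by (simp only: power_divide times_divide_eq_right)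
    qed
    also have "\<dots> \<le> measure lebesgue (E x r)"
    proof -
      have "0 < ((1 + \<kappa>) * ?N) ^ ?n" using \<open>0 < t\<close> \<open>0 < K\<close> \<open>0 \<le> \<kappa>\<close> by (intro zero_less_power mult_pos_pos) auto
      with bound show ?thesis by (simp add: pos_divide_le_eq mult.commute)
    qed
    finally show ?thesis using r by blast
  qed
  then obtain r where r: "\<And>x. x \<in> ?W \<Longrightarrow> 0 < r x" "\<And>x. x \<in> ?W \<Longrightarrow> r x \<le> \<delta>"
    "\<And>x. x \<in> ?W \<Longrightarrow> \<mu> * measure lebesgue (ball x (9 / 4 * (2 * r x))) \<le> measure lebesgue (E x (r x))"
    by metis
  let ?A = "A_minus t u \<Omega> \<inter> ball 0 (\<rho> + 2 * \<delta>)"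
  have compact_bound: "\<mu> * measure lebesgue Q \<le> measure lebesgue ?A - measure lebesgue ?W"
    if Q: "compact Q" "Q \<subseteq> ?W" for Q
  proof -
    have rQ: "0 < 2 * r x" if "x \<in> Q" for x
    proof -
      have "x \<in> ?W" using that Q(2) by blast
      from r(1)[OF this] show ?thesis by simp
    qed
    obtain C where C: "finite C" "C \<subseteq> Q" "pairwise (\<lambda>x y. disjnt (ball x (2 * r x)) (ball y (2 * r y))) C"
      "Q \<subseteq> (\<Union>x\<in>C. ball x (9 / 4 * (2 * r x)))"
      by (rule compact_cover_disjoint_balls[OF Q(1) rQ])
    have "measure lebesgue Q \<le> measure lebesgue (\<Union>x\<in>C. ball x (9 / 4 * (2 * r x)))"
      using C Q by (intro measure_mono_fmeasurable fmeasurable.finite_UN) (auto intro: fmeasurableD lmeasurable_compact)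
    also have "\<dots> \<le> (\<Sum>x\<in>C. measure lebesgue (ball x (9 / 4 * (2 * r x))))"
      using C by (intro measure_UNION_le) auto
    finally have "\<mu> * measure lebesgue Q \<le> (\<Sum>x\<in>C. \<mu> * measure lebesgue (ball x (9 / 4 * (2 * r x))))"
      using \<open>0 < \<mu>\<close> by (simp add: sum_distrib_left[symmetric])
    also have "\<dots> \<le> (\<Sum>x\<in>C. measure lebesgue (E x (r x)))"
      using C Q r(3) by (intro sum_mono) blast
    also have "\<dots> = measure lebesgue (\<Union>x\<in>C. E x (r x))"
    proof (rule measure_UNION'[symmetric])
      show "pairwise (\<lambda>x y. disjnt (E x (r x)) (E y (r y))) C"
        by (rule pairwise_mono[OF C(3)]) (auto simp: E_def disjnt_iff)
    qed (use C Em in auto)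
    \<comment> \<open>Gained points are bad for \<open>t\<close> but good for \<open>?N\<close>, and
      lie within \<open>2 \<delta>\<close> of a centre in \<open>ball 0 \<rho>\<close>.\<close>
    also have "\<dots> \<le> measure lebesgue (?A - ?W)"
    proof (rule measure_mono_fmeasurable)
      show "(\<Union>x\<in>C. E x (r x)) \<subseteq> ?A - ?W"
      proof
        fix z assume "z \<in> (\<Union>x\<in>C. E x (r x))"
        then obtain x where x: "x \<in> ?W" "z \<in> E x (r x)" using C Q by blast
        then have "norm z < \<rho> + 2 * \<delta>"
          using r(2)[OF x(1)] norm_triangle_ineq[of x "z - x"] by (simp add: E_def dist_norm norm_minus_commute)
        with x(2) show "z \<in> ?A - ?W" by (auto simp: E_eq)
      qed
      show "(\<Union>x\<in>C. E x (r x)) \<in> sets lebesgue" using C Em by (intro sets.finite_UN) auto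
      show "?A - ?W \<in> lmeasurable"
        using meas \<open>0 < t\<close> \<open>0 < ?N\<close> by (intro fmeasurable.Diff) auto
    qed
    also have "\<dots> = measure lebesgue ?A - measure lebesgue ?W"
      using meas \<open>0 < t\<close> \<open>0 < ?N\<close> A_minus_antimono[OF \<open>t \<le> ?N\<close>, of u \<Omega>] \<delta>(1)
      by (intro measurable_measure_Diff) (auto intro: fmeasurableD)
    finally show ?thesis .
  qed
  \<comment> \<open>Inner regularity extends the bound from compact subsets to
    \<open>?W\<close>.\<close>
  have "\<mu> * measure lebesgue ?W \<le> measure lebesgue ?A - measure lebesgue ?W"
  proof (rule field_le_epsilon)
    fix \<epsilon> :: real assume "0 < \<epsilon>"
    have Wm: "?W \<in> lmeasurable" using meas \<open>0 < ?N\<close> by simp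
    have "0 < \<epsilon> / \<mu>" using \<open>0 < \<epsilon>\<close> \<open>0 < \<mu>\<close> by simp
    then obtain Q where Q: "closed Q" "Q \<subseteq> ?W" "?W - Q \<in> lmeasurable" "emeasure lebesgue (?W - Q) < ennreal (\<epsilon> / \<mu>)"
      using sets_lebesgue_inner_closed fmeasurableD[OF Wm] by metis
    have "bounded Q" using Q(2) bounded_subset[OF bounded_ball, of Q 0 \<rho>] by blast
    then have "compact Q" using Q(1) compact_eq_bounded_closed by blast
    have "measure lebesgue (?W - Q) \<le> \<epsilon> / \<mu>"
      using Q(3,4) \<open>0 < \<epsilon> / \<mu>\<close> by (simp add: emeasure_eq_measure2 ennreal_less_iff)
    moreover have "measure lebesgue (?W - Q) = measure lebesgue ?W - measure lebesgue Q"
      using Wm Q(2) \<open>compact Q\<close> by (intro measurable_measure_Diff) (auto intro: fmeasurableD lmeasurable_compact)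
    ultimately have "\<mu> * measure lebesgue ?W \<le> \<mu> * (measure lebesgue Q + \<epsilon> / \<mu>)"
      using \<open>0 < \<mu>\<close> by (intro mult_left_mono) auto
    also have "\<dots> = \<mu> * measure lebesgue Q + \<epsilon>" using \<open>0 < \<mu>\<close> by (simp add: distrib_left)
    finally show "\<mu> * measure lebesgue ?W \<le> measure lebesgue ?A - measure lebesgue ?W + \<epsilon>"
      using compact_bound[OF \<open>compact Q\<close> Q(2)] by simp
  qed
  then show ?thesis by (simp add: \<mu>_def distrib_right)
qed

section \<open>Numerical bounds for the exponent\<close>

text \<open>The value at \<open>n = 2\<close> is \<open>81/32\<close>, which dictates the constant;
  from \<open>n = 6\<close> on the base is at most \<open>1\<close>.\<close>

lemma nine_quarters_power_le:
  assumes "2 \<le> n"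
  shows "(9 / (4 * sqrt (real n))) ^ n \<le> 2.54"
proof -
  have half: "(9 / (4 * sqrt x)) ^ 2 = 81 / (16 * x)" if "0 < x" for x :: real
    using that by (simp add: power_divide power_mult_distrib)
  consider "n = 2" | "n = 3" | "n = 4" | "n = 5" | "6 \<le> n" using assms by linarith
  then show ?thesis
  proof cases
    case 1
    then show ?thesis using half[of 2] by simp
  next
    case 2
    have "1.7 \<le> sqrt 3" by (rule real_le_rsqrt) (simp add: power2_eq_square)
    then have *: "9 / (4 * sqrt 3) \<le> 9 / (4 * 1.7)" by (intro divide_left_mono) auto
    have half3: "(9 / (4 * sqrt 3)) ^ 2 = (81 / 48 :: real)" using half[of 3] by simp
    have "(9 / (4 * sqrt 3)) ^ 3 = (9 / (4 * sqrt 3)) ^ 2 * (9 / (4 * sqrt 3))"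
      by (simp add: power3_eq_cube power2_eq_square)
    also have "\<dots> \<le> 81 / 48 * (9 / (4 * 1.7))" unfolding half3 by (rule mult_left_mono[OF *]) simp
    finally show ?thesis using 2 by simp
  next
    case 3
    have "(9 / (4 * sqrt 4)) ^ 4 = ((9 / (4 * sqrt 4)) ^ 2) ^ (2 :: nat)"
      by (simp only: power_mult[symmetric]) simp
    then show ?thesis using 3 half[of 4] by (simp add: power2_eq_square)
  next
    case 4
    have "2.2 \<le> sqrt 5" by (rule real_le_rsqrt) (simp add: power2_eq_square)
    then have *: "9 / (4 * sqrt 5) \<le> 9 / (4 * 2.2)" by (intro divide_left_mono) auto
    have half5: "(9 / (4 * sqrt 5)) ^ 2 = (81 / 80 :: real)" using half[of 5] by simp
    have "(9 / (4 * sqrt 5)) ^ 5 = ((9 / (4 * sqrt 5)) ^ 2) ^ 2 * (9 / (4 * sqrt 5))"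
      by (simp add: eval_nat_numeral)
    also have "\<dots> \<le> (81 / 80) ^ 2 * (9 / (4 * 2.2))" unfolding half5 by (rule mult_left_mono[OF *]) simp
    finally show ?thesis using 4 by (simp add: power2_eq_square)
  next
    case 5
    have "9 / 4 \<le> sqrt (real n)" using 5 by (intro real_le_rsqrt) (simp add: power2_eq_square)
    moreover have "0 < sqrt (real n)" using 5 by simp
    ultimately have "9 / (4 * sqrt (real n)) \<le> 1" by (simp add: divide_le_eq_1_pos)
    then have "(9 / (4 * sqrt (real n))) ^ n \<le> 1" by (intro power_le_one) auto
    then show ?thesis by simp
  qed
qed

text \<open>The power is at most \<open>exp (n / K) \<le> exp (1/16)\<close>, and
  \<open>exp (- 1/16) \<ge> 15/16\<close>.\<close>

lemma one_plus_inverse_power_le: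
  assumes "0 < n" "16 * real n \<le> K"
  shows "((K + 1) / K) ^ n \<le> 16 / 15"
proof -
  have "0 < K" using assms by linarith
  have "((K + 1) / K) ^ n \<le> (exp (1 / K)) ^ n"
    using \<open>0 < K\<close> exp_ge_add_one_self[of "1 / K"] by (intro power_mono) (auto simp: add_divide_distrib)
  also have "\<dots> = exp (real n / K)" by (simp add: exp_of_nat_mult[symmetric])
  also have "\<dots> \<le> exp (1 / 16)" using assms \<open>0 < K\<close> by (simp add: field_simps)
  also have "\<dots> \<le> 16 / 15"
  proof -
    have "15 / 16 \<le> exp (- (1 / 16) :: real)" using exp_ge_add_one_self[of "- (1 / 16) :: real"] by simp
    then show ?thesis by (simp add: exp_minus field_simps)
  qed
  finally show ?thesis .
qed

text \<open>The cube supplies the factor \<open>3\<close> spent in \<open>exponent_bound\<close>.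
  With \<open>m = max 1 (\<kappa> - 1)\<close> the base is at most \<open>27 n m\<close>; then
  \<open>27^3 < 10^5\<close>, while \<open>m^3 \<le> exp (3 m) \<le> (36 n)^m\<close>.\<close>

lemma growth_factor_cube_less:
  assumes n: "2 \<le> n" and \<kappa>: "real n - 1 \<le> \<kappa>"
  shows "(8 * real n * (1 + \<kappa>) + 1) ^ 3 < 10 ^ 5 * real n ^ 3 * (36 * real n) powr max 1 (\<kappa> - 1)"
proof -
  define m where "m = max 1 (\<kappa> - 1)"
  have m: "1 \<le> m" "\<kappa> \<le> m + 1" by (auto simp: m_def)
  have "1 \<le> \<kappa>" using n \<kappa> by simp
  have nk: "4 \<le> real n * (1 + \<kappa>)" using mult_mono[of 2 "real n" 2 "1 + \<kappa>"] n \<open>1 \<le> \<kappa>\<close> by simp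
  have "(8 * real n * (1 + \<kappa>) + 1) ^ 3 \<le> (9 * real n * (3 * m)) ^ 3"
  proof (intro power_mono)
    have "real n * (1 + \<kappa>) \<le> real n * (3 * m)" using m by (intro mult_left_mono) auto
    with nk show "8 * real n * (1 + \<kappa>) + 1 \<le> 9 * real n * (3 * m)" by simp
  qed (use \<open>1 \<le> \<kappa>\<close> in simp)
  also have "\<dots> = 19683 * real n ^ 3 * m ^ 3" by (simp add: power_mult_distrib)
  also have "\<dots> \<le> 19683 * real n ^ 3 * (36 * real n) powr m"
  proof (intro mult_left_mono)
    have "m \<le> exp m" using exp_ge_add_one_self[of m] by linarith
    then have "m ^ 3 \<le> exp m ^ 3" using m by (intro power_mono) auto
    also have "\<dots> = exp 3 powr m" by (simp add: exp_of_nat_mult[symmetric] powr_def mult.commute)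
    also have "\<dots> \<le> (36 * real n) powr m"
    proof (intro powr_mono2)
      have "exp 1 ^ 3 \<le> (3 :: real) ^ 3" using exp_le by (intro power_mono) auto
      then show "exp 3 \<le> 36 * real n" using n exp_of_nat_mult[of 3 "1 :: real"] by simp
    qed (use m in auto)
    finally show "m ^ 3 \<le> (36 * real n) powr m" .
  qed simp
  also have "\<dots> < 10 ^ 5 * real n ^ 3 * (36 * real n) powr m"
    using n by simp
  finally show ?thesis by (simp add: m_def)
qed

lemma ln_one_plus_ge:
  assumes "0 \<le> x"
  shows "x / (1 + x) \<le> ln (1 + x :: real)"
proof -
  have "ln (1 / (1 + x)) \<le> 1 / (1 + x) - 1" using assms by (intro ln_le_minus_one) simp
  then show ?thesis using assms by (simp add: ln_div field_simps)
qed

text \<open>Numerator and denominator are compared separately: the two powers on the left are at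
  most \<open>3 \<mu> / (1 + \<mu>) \<le> 3 ln (1 + \<mu>)\<close>, and the logarithm on the left
  exceeds \<open>3 ln (K + 1)\<close>.\<close>

lemma exponent_bound:
  assumes n: "2 \<le> n" and \<kappa>: "real n - 1 \<le> \<kappa>" and K: "K = 8 * real n * (1 + \<kappa>)"
  defines "\<mu> \<equiv> (K / ((K + 1) * (1 + \<kappa>) * 9)) ^ n"
  shows "(1 / (1 + \<kappa>)) ^ n * (1 / (4 * sqrt (real n))) ^ n *
      (1 / ln (10 ^ 5 * real n ^ 3 * (36 * real n) powr max 1 (\<kappa> - 1))) < ln (1 + \<mu>) / ln (K + 1)"
    (is "?\<mu>0 * ?s * (1 / ?l) < _")
proof -
  have "1 \<le> \<kappa>" using n \<kappa> by simp
  have "8 * real n * 2 \<le> 8 * real n * (1 + \<kappa>)" using \<open>1 \<le> \<kappa>\<close> by (intro mult_left_mono) auto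
  then have K32: "16 * real n \<le> K" "0 < K" using n by (simp_all add: K[symmetric])
  have "0 < \<mu>" using \<open>1 \<le> \<kappa>\<close> K32 by (simp add: \<mu>_def)
  have "0 < ln (K + 1)" using K32 by simp
  have "\<mu> \<le> (1 / 18) ^ n"
    unfolding \<mu>_def
  proof (intro power_mono)
    have "K * 18 \<le> (K + 1) * (1 + \<kappa>) * 9"
      using mult_mono[of K "K + 1" 2 "1 + \<kappa>"] K32 \<open>1 \<le> \<kappa>\<close> by (simp add: mult.commute)
    then show "K / ((K + 1) * (1 + \<kappa>) * 9) \<le> 1 / 18"
      using K32 \<open>1 \<le> \<kappa>\<close> by (simp add: pos_divide_le_eq)
  qed (use K32 \<open>1 \<le> \<kappa>\<close> in simp)
  also have "\<dots> \<le> (1 / 18) ^ 2" using n by (intro power_decreasing) auto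
  finally have mu_le: "1 + \<mu> \<le> 325 / 324" by (simp add: power2_eq_square)
  have "?\<mu>0 * ?s = \<mu> * ((9 / (4 * sqrt (real n))) ^ n * ((K + 1) / K) ^ n)"
  proof -
    have "1 / (1 + \<kappa>) * (1 / (4 * sqrt (real n)))
        = K / ((K + 1) * (1 + \<kappa>) * 9) * (9 / (4 * sqrt (real n)) * ((K + 1) / K))"
    proof -
      have gen: "1 / a * (1 / (4 * s)) = K / (M * a * 9) * (9 / (4 * s) * (M / K))" if "M \<noteq> 0" for a s M :: real
        using that K32 by simp
      show ?thesis by (rule gen) (use K32 in simp)
    qed
    then show ?thesis by (simp only: \<mu>_def power_mult_distrib[symmetric])
  qed
  \<comment> \<open>\<open>2.54 * 16/15 < 2.71\<close>, whereas
    \<open>3 / (1 + \<mu>) \<ge> 3 * 324/325 > 2.99\<close>.\<close>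
  also have "\<dots> \<le> \<mu> * (2.54 * (16 / 15))"
    using nine_quarters_power_le[OF n] one_plus_inverse_power_le[of n K] K32 n \<open>0 < \<mu>\<close>
    by (intro mult_left_mono mult_mono) auto
  also have "\<dots> \<le> \<mu> * (3 / (1 + \<mu>))"
    using mu_le \<open>0 < \<mu>\<close> by (intro mult_left_mono) (auto simp: pos_le_divide_eq)
  finally have le3: "?\<mu>0 * ?s \<le> 3 * (\<mu> / (1 + \<mu>))" by (simp add: mult.commute)
  have cube: "(K + 1) ^ 3 < 10 ^ 5 * real n ^ 3 * (36 * real n) powr max 1 (\<kappa> - 1)"
    using growth_factor_cube_less[OF n \<kappa>] by (simp only: K)
  have "3 * ln (K + 1) = ln ((K + 1) ^ 3)" using K32 by (simp add: ln_realpow)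
  also have "\<dots> < ?l"
    using cube K32 n by (subst ln_less_cancel_iff) auto
  finally have l: "3 * ln (K + 1) < ?l" .
  then have "0 < ?l" using \<open>0 < ln (K + 1)\<close> by linarith
  have "?\<mu>0 * ?s * (1 / ?l) \<le> 3 * (\<mu> / (1 + \<mu>)) * (1 / ?l)"
    using le3 \<open>0 < ?l\<close> by (intro mult_right_mono) auto
  also have "\<dots> < 3 * (\<mu> / (1 + \<mu>)) * (1 / (3 * ln (K + 1)))"
    using l \<open>0 < ln (K + 1)\<close> \<open>0 < \<mu>\<close> by (intro mult_strict_left_mono divide_strict_left_mono) auto
  also have "\<dots> = (\<mu> / (1 + \<mu>)) / ln (K + 1)" by simp
  also have "\<dots> \<le> ln (1 + \<mu>) / ln (K + 1)"
    using ln_one_plus_ge[of \<mu>] \<open>0 < \<mu>\<close> \<open>0 < ln (K + 1)\<close> by (intro divide_right_mono) auto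
  finally show ?thesis .
qed

text \<open>\<open>\<mu>\<close> costs the power \<open>n\<close> of \<open>X\<close>, and the crude
  bound \<open>ln (K + 1) \<le> K \<le> 8 n^2 X\<close> costs one more. With
  \<open>ln (1 + \<mu>) \<ge> \<mu> / 2\<close> the constant would be \<open>16\<close>;
  \<open>20\<close> makes the inequality strict.\<close>

lemma exponent_polynomial_bound:
  assumes n: "2 \<le> n" and \<kappa>: "real n - 1 \<le> \<kappa>" "\<kappa> = (real n - 1) * X" and K: "K = 8 * real n * (1 + \<kappa>)"
  shows "X powr (- real (n + 1)) * ((1 / (18 * real n)) ^ n / (20 * (real n)\<^sup>2))
    < ln (1 + (K / ((K + 1) * (1 + \<kappa>) * 9)) ^ n) / ln (K + 1)"
proof -
  define \<mu> where "\<mu> = (K / ((K + 1) * (1 + \<kappa>) * 9)) ^ n"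
  have "1 \<le> \<kappa>" using n \<kappa>(1) by simp
  have "1 \<le> X" using n \<kappa> mult_less_cancel_left_pos[of "real n - 1" X 1] by (auto simp: not_less[symmetric])
  have "8 * real n * 2 \<le> 8 * real n * (1 + \<kappa>)" using \<open>1 \<le> \<kappa>\<close> by (intro mult_left_mono) auto
  then have "16 * real n \<le> K" by (simp add: K[symmetric])
  then have "1 \<le> K" using n by linarith
  have "0 < \<mu>" using \<open>1 \<le> \<kappa>\<close> \<open>1 \<le> K\<close> by (simp add: \<mu>_def)
  have le: "1 + \<kappa> \<le> real n * X" 
  proof -
    have "real n * X = (real n - 1) * X + X" by (simp add: algebra_simps)
    with \<open>1 \<le> X\<close> \<kappa>(2) show ?thesis by linarith
  qed
  have mu_le1: "\<mu> \<le> 1"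
    unfolding \<mu>_def
  proof (intro power_le_one)
    have "K \<le> (K + 1) * (1 + \<kappa>) * 9"
      using mult_mono[of K "K + 1" 1 "1 + \<kappa>"] \<open>1 \<le> K\<close> \<open>1 \<le> \<kappa>\<close> by simp
    then show "K / ((K + 1) * (1 + \<kappa>) * 9) \<le> 1"
      using \<open>1 \<le> K\<close> \<open>1 \<le> \<kappa>\<close> by (simp add: pos_divide_le_eq)
  qed (use \<open>1 \<le> K\<close> \<open>1 \<le> \<kappa>\<close> in simp)
  have mu_ge: "(1 / (18 * real n * X)) ^ n \<le> \<mu>"
    unfolding \<mu>_def
  proof (intro power_mono)
    have "(K + 1) * (1 + \<kappa>) * 9 \<le> (2 * K) * (real n * X) * 9"
      using le \<open>1 \<le> K\<close> \<open>1 \<le> \<kappa>\<close> by (intro mult_right_mono mult_mono) auto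
    then have "K / ((2 * K) * (real n * X) * 9) \<le> K / ((K + 1) * (1 + \<kappa>) * 9)"
      by (intro divide_left_mono mult_pos_pos) (use \<open>1 \<le> K\<close> \<open>1 \<le> \<kappa>\<close> \<open>1 \<le> X\<close> n in auto)
    then show "1 / (18 * real n * X) \<le> K / ((K + 1) * (1 + \<kappa>) * 9)"
      using \<open>1 \<le> K\<close> by simp
  qed (use \<open>1 \<le> X\<close> in simp)
  have lnK: "0 < ln (K + 1)" "ln (K + 1) \<le> 8 * (real n)\<^sup>2 * X"
  proof -
    show "0 < ln (K + 1)" using \<open>1 \<le> K\<close> by simp
    have "ln (K + 1) \<le> K" using \<open>1 \<le> K\<close> ln_le_minus_one[of "K + 1"] by simp
    also have "\<dots> \<le> 8 * real n * (real n * X)" unfolding K using le by (intro mult_left_mono) auto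
    finally show "ln (K + 1) \<le> 8 * (real n)\<^sup>2 * X" by (simp add: power2_eq_square)
  qed
  have pos: "0 < (1 / (18 * real n * X)) ^ n" using n \<open>1 \<le> X\<close> by simp
  have "X powr (- real (n + 1)) = 1 / (X ^ n * X)"
    using \<open>1 \<le> X\<close> by (subst powr_minus, subst powr_realpow) (auto simp: divide_inverse)
  then have "X powr (- real (n + 1)) * ((1 / (18 * real n)) ^ n / (20 * (real n)\<^sup>2))
      = (1 / (18 * real n * X)) ^ n / (20 * ((real n)\<^sup>2 * X))"
    by (simp add: power_divide power_mult_distrib)
  also have "\<dots> < (1 / (18 * real n * X)) ^ n / (16 * ((real n)\<^sup>2 * X))"
    using pos n \<open>1 \<le> X\<close> by (intro divide_strict_left_mono) auto
  also have "\<dots> \<le> \<mu> / (2 * ln (K + 1))"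
    using mu_ge lnK \<open>0 < \<mu>\<close> by (intro frac_le) (auto simp: mult_ac)
  also have "\<dots> = (\<mu> / 2) / ln (K + 1)" by simp
  also have "\<dots> \<le> ln (1 + \<mu>) / ln (K + 1)"
  proof (intro divide_right_mono)
    have "\<mu> / 2 \<le> \<mu> / (1 + \<mu>)" using mu_le1 \<open>0 < \<mu>\<close> by (intro divide_left_mono) auto
    then show "\<mu> / 2 \<le> ln (1 + \<mu>)" using ln_one_plus_ge[OF less_imp_le[OF \<open>0 < \<mu>\<close>]] by linarith
  qed (use lnK in simp)
  finally show ?thesis by (simp add: \<mu>_def)
qed

section \<open>Power decay\<close>

text \<open>Iterates \<open>measure_A_minus_step\<close>, each level using the previous one on a
  larger ball. The admissible radii shrink from \<open>3/4\<close> towards \<open>1/2\<close>, so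
  all levels control the ball of radius \<open>1/2\<close>.\<close>

lemma measure_A_minus_geometric_decay:
  fixes u :: "real^'n \<Rightarrow> real"
  defines "\<Omega> \<equiv> ball 0 1"
  assumes lam: "0 < lam" "lam \<le> Lam" and u: "continuous_on \<Omega> u" "visc_pucci_minus_le_0 lam Lam \<Omega> u"
    and S: "\<And>z. z \<in> \<Omega> \<Longrightarrow> \<bar>u z\<bar> \<le> S" "0 < S"
    and \<kappa>_def: "\<kappa> = (real CARD('n) - 1) * Lam / lam" and K: "8 * (1 + \<kappa>) \<le> K" "32 \<le> K"
    and \<mu>_def: "\<mu> = (K / ((K + 1) * (1 + \<kappa>) * 9)) ^ CARD('n)"
  shows "\<rho> \<le> 1 / 2 + (1 / 4) ^ k / 4 \<Longrightarrow>
    measure lebesgue (A_minus ((K + 1) ^ k * (2304 * K * S)) u \<Omega> \<inter> ball 0 \<rho>)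
      \<le> (1 / (1 + \<mu>)) ^ k * measure lebesgue (ball (0 :: real^'n) 1)"
proof (induction k arbitrary: \<rho>)
  case 0
  have "A_minus (2304 * K * S) u \<Omega> \<inter> ball 0 \<rho> \<in> sets lebesgue"
    using open_A_minus[OF _ u(1) S(1), of "2304 * K * S"] S(2) K by (auto simp: \<Omega>_def)
  then have "measure lebesgue (A_minus (2304 * K * S) u \<Omega> \<inter> ball 0 \<rho>) \<le> measure lebesgue (ball (0 :: real^'n) 1)"
    by (intro measure_mono_fmeasurable) (auto simp: A_minus_def \<Omega>_def)
  then show ?case by simp
next
  case (Suc k)
  define t where "t = (K + 1) ^ k * (2304 * K * S)"
  \<comment> \<open>\<open>t\<close> grows by \<open>K + 1 \<ge> 16\<close> per level, so
    \<open>\<delta>\<close> may shrink by \<open>4\<close> while \<open>t * \<delta>^2\<close> stays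
    at least \<open>4 * S\<close>; here \<open>4 = 2304 / 576\<close>. The factor
    \<open>1 / (24 sqrt K)\<close> gives \<open>9 K \<delta>^2 \<le> 1/64\<close>.\<close>
  define \<delta> where "\<delta> = (1 / 4) ^ k * (1 / (24 * sqrt K))"
  have "0 < t" using K S by (simp add: t_def)
  have "0 \<le> \<kappa>" using lam by (simp add: \<kappa>_def Suc_leI)
  then have "0 < \<mu>" using K by (simp add: \<mu>_def)
  have "5 \<le> sqrt K" using K by (intro real_le_rsqrt) (simp add: power2_eq_square)
  then have \<delta>0: "1 / (24 * sqrt K) \<le> 1 / 120" "0 < 1 / (24 * sqrt K)"
    using frac_le[of 1 1 120 "24 * sqrt K"] K by auto
  have q: "(1 / 4 :: real) ^ k \<le> 1" "0 < (1 / 4 :: real) ^ k" by (auto intro: power_le_one)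
  have \<delta>: "0 < \<delta>" "\<delta> \<le> (1 / 4) ^ k * (1 / 120)"
    unfolding \<delta>_def by (rule mult_pos_pos[OF q(2) \<delta>0(2)], rule mult_left_mono[OF \<delta>0(1)]) simp
  have \<delta>2: "\<delta>\<^sup>2 = (1 / 16) ^ k / (576 * K)"
  proof -
    have "((4 :: real) ^ k)\<^sup>2 = (4\<^sup>2) ^ k" by (simp only: power_mult[symmetric] mult.commute)
    then show ?thesis using K by (simp add: \<delta>_def power_mult_distrib power_divide)
  qed
  have "(1 + \<mu>) * measure lebesgue (A_minus ((K + 1) * t) u \<Omega> \<inter> ball 0 \<rho>)
      \<le> measure lebesgue (A_minus t u \<Omega> \<inter> ball 0 (\<rho> + 2 * \<delta>))"
    unfolding \<mu>_def \<Omega>_def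
  proof (rule measure_A_minus_step[OF lam u[unfolded \<Omega>_def] S(1)[unfolded \<Omega>_def] \<kappa>_def K(1) \<open>0 < t\<close> \<delta>(1)])
    have "1 \<le> ((K + 1) / 16) ^ k" using K by (intro one_le_power) simp
    then have "4 * S * 1 \<le> 4 * S * ((K + 1) / 16) ^ k" using S by (intro mult_left_mono) auto
    also have "\<dots> = t * \<delta>\<^sup>2" unfolding \<delta>2 t_def using K by (simp add: power_divide)
    finally show "4 * S \<le> t * \<delta>\<^sup>2" by simp
    show "\<rho> + 2 * \<delta> \<le> 3 / 4" using Suc.prems \<delta> q by simp
    show "6 * \<delta> < 1 / 8" using \<delta> q by simp
    have "9 * K * \<delta>\<^sup>2 = (1 / 16) ^ k / 64" unfolding \<delta>2 using K by simp
    also have "\<dots> \<le> (1 / 8)\<^sup>2" by (simp add: power2_eq_square power_le_one)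
    finally show "9 * K * \<delta>\<^sup>2 \<le> (1 / 8)\<^sup>2" .
  qed
  also have "\<dots> \<le> (1 / (1 + \<mu>)) ^ k * measure lebesgue (ball (0 :: real^'n) 1)"
    unfolding t_def by (rule Suc.IH) (use Suc.prems \<delta> q in simp)
  finally have "measure lebesgue (A_minus ((K + 1) * t) u \<Omega> \<inter> ball 0 \<rho>)
      \<le> (1 / (1 + \<mu>)) ^ k * measure lebesgue (ball (0 :: real^'n) 1) / (1 + \<mu>)"
    using \<open>0 < \<mu>\<close> by (simp only: pos_le_divide_eq mult.commute[of _ "1 + \<mu>"])
  also have "\<dots> = (1 / (1 + \<mu>)) ^ Suc k * measure lebesgue (ball (0 :: real^'n) 1)" by simp
  finally show ?case by (simp only: t_def power_Suc mult.assoc)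
qed

text \<open>Interpolates between the geometric levels: \<open>t\<close> is compared with the highest
  level below it, at the cost of one factor \<open>1 + \<mu>\<close>.\<close>

lemma measure_A_minus_power_decay:
  fixes u :: "real^'n \<Rightarrow> real"
  defines "\<Omega> \<equiv> ball 0 1"
  assumes lam: "0 < lam" "lam \<le> Lam" and u: "continuous_on \<Omega> u" "visc_pucci_minus_le_0 lam Lam \<Omega> u"
    and S: "\<And>z. z \<in> \<Omega> \<Longrightarrow> \<bar>u z\<bar> \<le> S" "0 < S"
    and \<kappa>_def: "\<kappa> = (real CARD('n) - 1) * Lam / lam" and K: "8 * (1 + \<kappa>) \<le> K" "32 \<le> K"
    and \<mu>_def: "\<mu> = (K / ((K + 1) * (1 + \<kappa>) * 9)) ^ CARD('n)" and \<epsilon>_def: "\<epsilon> = ln (1 + \<mu>) / ln (K + 1)"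
    and t: "2304 * K * S < t"
  shows "measure lebesgue (A_minus t u \<Omega> \<inter> ball 0 (1 / 2))
    \<le> (1 + \<mu>) * (2304 * K) powr \<epsilon> * measure lebesgue (ball (0 :: real^'n) 1) * S powr \<epsilon> * t powr (- \<epsilon>)"
proof -
  let ?t0 = "2304 * K" and ?B = "measure lebesgue (ball (0 :: real^'n) 1)"
  have "0 \<le> \<kappa>" using lam by (simp add: \<kappa>_def Suc_leI)
  then have "0 < \<mu>" using K by (simp add: \<mu>_def)
  then have "0 < \<epsilon>" using K by (simp add: \<epsilon>_def)
  have "0 < ?t0 * S" using K S by simp
  define q where "q = t / (?t0 * S)"
  have "1 < q" using t \<open>0 < ?t0 * S\<close> by (simp add: q_def)
  obtain j0 where "q < (K + 1) ^ j0" using real_arch_pow[of "K + 1" q] K by auto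
  \<comment> \<open>The first power exceeding \<open>q\<close>. Since \<open>q > 1\<close> it is not
    the zeroth, so its predecessor \<open>k\<close> brackets \<open>q\<close> from below.\<close>
  define j where "j = (LEAST i. q < (K + 1) ^ i)"
  have j: "q < (K + 1) ^ j" "\<And>i. i < j \<Longrightarrow> \<not> q < (K + 1) ^ i"
    unfolding j_def by (rule LeastI[of "\<lambda>i. q < (K + 1) ^ i"], fact) (rule not_less_Least)
  have "j \<noteq> 0"
  proof
    assume "j = 0"
    with j(1) \<open>1 < q\<close> show False by simp
  qed
  then obtain k where k: "j = Suc k" by (cases j) auto
  have q: "(K + 1) ^ k \<le> q" "q < (K + 1) ^ Suc k" using j k by (auto simp: not_less)
  have tq: "t = q * (?t0 * S)" using K S by (simp add: q_def)
  \<comment> \<open>This identity is the reason for the choice of \<open>\<epsilon>\<close>.\<close>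
  have base: "(K + 1) powr \<epsilon> = 1 + \<mu>"
    using K \<open>0 < \<mu>\<close> by (simp add: powr_def \<epsilon>_def)
  have "q powr \<epsilon> \<le> ((K + 1) ^ Suc k) powr \<epsilon>"
    using q \<open>1 < q\<close> \<open>0 < \<epsilon>\<close> by (intro powr_mono2) auto
  also have "\<dots> = ((K + 1) powr \<epsilon>) ^ Suc k"
    using K by (simp add: powr_powr powr_realpow[symmetric] mult.commute del: power_Suc of_nat_Suc)
  finally have qle: "q powr \<epsilon> \<le> (1 + \<mu>) ^ Suc k" unfolding base .
  have "0 < q powr \<epsilon>" using \<open>1 < q\<close> by simp
  have le: "(1 / (1 + \<mu>)) ^ k \<le> (1 + \<mu>) * q powr (- \<epsilon>)"
    using qle \<open>0 < q powr \<epsilon>\<close> \<open>0 < \<mu>\<close> by (simp add: powr_minus_divide power_divide pos_le_divide_eq pos_divide_le_eq)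
  have "(K + 1) ^ k * (?t0 * S) \<le> t" unfolding tq using q(1) \<open>0 < ?t0 * S\<close> by (intro mult_right_mono) auto
  then have "A_minus t u \<Omega> \<inter> ball 0 (1 / 2) \<subseteq> A_minus ((K + 1) ^ k * (?t0 * S)) u \<Omega> \<inter> ball 0 (1 / 2)"
    using A_minus_antimono by blast
  moreover have op: "open (A_minus a u \<Omega>)" if "0 \<le> a" for a
    by (rule open_A_minus[OF _ u(1) S(1) that]) (auto simp: \<Omega>_def)
  have "0 < t" using t \<open>0 < ?t0 * S\<close> by linarith
  then have "open (A_minus t u \<Omega>)" by (intro op) simp
  moreover have "open (A_minus ((K + 1) ^ k * (?t0 * S)) u \<Omega>)"
    using K S by (intro op mult_nonneg_nonneg zero_le_power) auto
  ultimately have "measure lebesgue (A_minus t u \<Omega> \<inter> ball 0 (1 / 2))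
      \<le> measure lebesgue (A_minus ((K + 1) ^ k * (?t0 * S)) u \<Omega> \<inter> ball 0 (1 / 2))"
    by (intro measure_mono_fmeasurable lmeasurable_open)
      (auto intro: bounded_subset[OF bounded_ball])
  also have "\<dots> \<le> (1 / (1 + \<mu>)) ^ k * ?B"
    unfolding \<Omega>_def
    by (rule measure_A_minus_geometric_decay[OF lam u[unfolded \<Omega>_def] S[unfolded \<Omega>_def] \<kappa>_def K \<mu>_def]) auto
  also have "\<dots> \<le> (1 + \<mu>) * q powr (- \<epsilon>) * ?B"
    using le by (intro mult_right_mono) auto
  also have "q powr (- \<epsilon>) = ?t0 powr \<epsilon> * S powr \<epsilon> * t powr (- \<epsilon>)"
  proof -
    show ?thesis using K S \<open>0 < t\<close> by (simp add: q_def powr_divide powr_mult powr_minus_divide)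
  qed
  finally show ?thesis by (simp only: mult.assoc mult.commute[of _ ?B] mult.left_commute[of _ ?B])
qed

section \<open>Superlevel sets of \<open>Theta_lower\<close> and the final constants\<close>

lemma A_minus_zero_on:
  assumes "\<And>z. z \<in> \<Omega> \<Longrightarrow> u z = 0" "0 \<le> t"
  shows "A_minus t u \<Omega> = {}"
proof -
  have "x \<in> G_minus t u \<Omega>" if "x \<in> \<Omega>" for x
    using assms that by (auto simp: G_minus_def intro!: exI[of _ 0])
  then show ?thesis by (auto simp: A_minus_def)
qed

text \<open>At a good point for \<open>t\<close>, the number \<open>t\<close> itself competes in the
  infimum.\<close>

lemma Theta_lower_superlevel_subset:
  assumes "0 \<le> t" "V \<subseteq> \<Omega>"
  shows "{x \<in> V. Theta_lower u \<Omega> x > ereal t} \<subseteq> A_minus t u \<Omega> \<inter> V"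
proof
  fix x assume "x \<in> {x \<in> V. Theta_lower u \<Omega> x > ereal t}"
  then have x: "x \<in> V" "x \<in> \<Omega>" "ereal t < Theta_lower u \<Omega> x" using assms by auto
  have "x \<notin> G_minus t u \<Omega>"
  proof
    assume "x \<in> G_minus t u \<Omega>"
    then have "\<exists>p. \<forall>y\<in>\<Omega>. u y \<ge> u x + p \<bullet> (y - x) - 1 / 2 * t * (norm (x - y))\<^sup>2"
      by (auto simp: G_minus_def norm_minus_commute)
    then have "Theta_lower u \<Omega> x \<le> ereal t"
      unfolding Theta_lower_def using assms by (intro Inf_lower) blast
    with x show False by simp
  qed
  with x show "x \<in> A_minus t u \<Omega> \<inter> V" by (simp add: A_minus_def)
qed

text \<open>An infinite supremum would make the threshold infinite, so a real \<open>t\<close> above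
  it forces \<open>u\<close> to be bounded.\<close>

lemma sup_abs_finite:
  assumes "\<Omega> \<noteq> {}" "0 < t0" "ereal t > ereal t0 * sup_abs u \<Omega>"
  obtains S where "sup_abs u \<Omega> = ereal S" "0 \<le> S" "\<And>z. z \<in> \<Omega> \<Longrightarrow> \<bar>u z\<bar> \<le> S" "t0 * S < t"
proof -
  have up: "ereal \<bar>u z\<bar> \<le> sup_abs u \<Omega>" if "z \<in> \<Omega>" for z
    unfolding sup_abs_def using that by (rule SUP_upper)
  then have nonneg: "0 \<le> sup_abs u \<Omega>"
    using assms(1) by (metis abs_ge_zero ereal_less_eq(5) equals0I order_trans)
  moreover have "sup_abs u \<Omega> \<noteq> \<infinity>" using assms(2,3) by auto
  ultimately obtain S where S: "sup_abs u \<Omega> = ereal S" by (cases "sup_abs u \<Omega>") auto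
  show ?thesis
    using that[OF S] up nonneg assms(3) unfolding S by simp
qed

text \<open>The power of the supremum on the right makes the estimate invariant under multiplying
  \<open>u\<close> and \<open>t\<close> by the same positive number, as constants independent of
  \<open>u\<close> demand.\<close>

theorem theorem1p4:
  fixes n :: nat
  assumes n_def: "n = CARD('n::finite)" and n_ge_2: "n \<ge> 2"
  shows "\<exists>c::real. c > 0 \<and>
    (\<forall>lam Lam :: real. 0 < lam \<and> lam \<le> Lam \<longrightarrow>
      (\<exists>C t0 \<epsilon> :: real. C > 0 \<and> t0 > 0 \<and> \<epsilon> > 0 \<and>
        \<epsilon> > (lam / (lam + (real n - 1) * Lam)) ^ n * (1 / (4 * sqrt (real n))) ^ n *
            (1 / ln (10 ^ 5 * real n ^ 3 *
               (36 * real n) powr max 1 ((real n - 1) * Lam / lam - 1))) \<and>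
        \<epsilon> > (Lam / lam) powr (- real (n + 1)) * c \<and>
        (\<forall>u :: real^'n \<Rightarrow> real.
          continuous_on (ball 0 1) u \<and> visc_pucci_minus_le_0 lam Lam (ball 0 1) u \<longrightarrow>
          (\<forall>t::real. ereal t > ereal t0 * sup_abs u (ball 0 1) \<longrightarrow>
            measure lebesgue (A_minus t u (ball 0 1) \<inter> ball 0 (1/2))
              \<le> C * (real_of_ereal (sup_abs u (ball 0 1))) powr \<epsilon> * t powr (- \<epsilon>) \<and>
            measure lebesgue {x \<in> ball 0 (1/2). Theta_lower u (ball 0 1) x > ereal t}
              \<le> C * (real_of_ereal (sup_abs u (ball 0 1))) powr \<epsilon> * t powr (- \<epsilon>)))))"
proof (rule exI[of _ "(1 / (18 * real n)) ^ n / (20 * (real n)\<^sup>2)"], intro conjI allI impI)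
  show "0 < (1 / (18 * real n)) ^ n / (20 * (real n)\<^sup>2)" using n_ge_2 by simp
  fix lam Lam :: real
  assume "0 < lam \<and> lam \<le> Lam"
  then have lam: "0 < lam" "lam \<le> Lam" by auto
  define \<kappa> where "\<kappa> = (real n - 1) * Lam / lam"
  \<comment> \<open>The factor \<open>n\<close> beyond \<open>8 (1 + \<kappa>)\<close> keeps
    \<open>((K + 1) / K) ^ n\<close> bounded in the exponent estimate.\<close>
  define K where "K = 8 * real n * (1 + \<kappa>)"
  define \<mu> where "\<mu> = (K / ((K + 1) * (1 + \<kappa>) * 9)) ^ n"
  define \<epsilon> where "\<epsilon> = ln (1 + \<mu>) / ln (K + 1)"
  define C where "C = (1 + \<mu>) * (2304 * K) powr \<epsilon> * measure lebesgue (ball (0 :: real^'n) 1)"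
  have \<kappa>: "real n - 1 \<le> \<kappa>" using lam n_ge_2 by (simp add: \<kappa>_def pos_le_divide_eq)
  then have "1 \<le> \<kappa>" using n_ge_2 by simp
  have K: "8 * (1 + \<kappa>) \<le> K" "32 \<le> K"
    using mult_mono[of 1 "real n" "8 * (1 + \<kappa>)" "8 * (1 + \<kappa>)"]
      mult_mono[of 2 "real n" 16 "8 * (1 + \<kappa>)"] n_ge_2 \<open>1 \<le> \<kappa>\<close> by (simp_all add: K_def mult_ac)
  have "0 < \<mu>" using K \<open>1 \<le> \<kappa>\<close> by (simp add: \<mu>_def)
  have "0 < \<epsilon>" using K \<open>0 < \<mu>\<close> by (simp add: \<epsilon>_def)
  have "0 < C" using K \<open>0 < \<mu>\<close> by (simp add: C_def content_ball_pos)
  have eq: "lam / (lam + (real n - 1) * Lam) = 1 / (1 + \<kappa>)"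
    using lam by (simp add: \<kappa>_def field_simps)
  have lower1: "(lam / (lam + (real n - 1) * Lam)) ^ n * (1 / (4 * sqrt (real n))) ^ n *
      (1 / ln (10 ^ 5 * real n ^ 3 * (36 * real n) powr max 1 ((real n - 1) * Lam / lam - 1))) < \<epsilon>"
    using exponent_bound[OF n_ge_2 \<kappa> K_def] unfolding eq \<epsilon>_def \<mu>_def \<kappa>_def[symmetric] .
  have lower2: "(Lam / lam) powr (- real (n + 1)) * ((1 / (18 * real n)) ^ n / (20 * (real n)\<^sup>2)) < \<epsilon>"
  proof -
    have "\<kappa> = (real n - 1) * (Lam / lam)" by (simp add: \<kappa>_def)
    from exponent_polynomial_bound[OF n_ge_2 \<kappa> this K_def] show ?thesis
      unfolding \<epsilon>_def \<mu>_def .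
  qed
  show "\<exists>C t0 \<epsilon> :: real. C > 0 \<and> t0 > 0 \<and> \<epsilon> > 0 \<and>
        \<epsilon> > (lam / (lam + (real n - 1) * Lam)) ^ n * (1 / (4 * sqrt (real n))) ^ n *
            (1 / ln (10 ^ 5 * real n ^ 3 *
               (36 * real n) powr max 1 ((real n - 1) * Lam / lam - 1))) \<and>
        \<epsilon> > (Lam / lam) powr (- real (n + 1)) * ((1 / (18 * real n)) ^ n / (20 * (real n)\<^sup>2)) \<and>
        (\<forall>u :: real^'n \<Rightarrow> real.
          continuous_on (ball 0 1) u \<and> visc_pucci_minus_le_0 lam Lam (ball 0 1) u \<longrightarrow>
          (\<forall>t::real. ereal t > ereal t0 * sup_abs u (ball 0 1) \<longrightarrow>
            measure lebesgue (A_minus t u (ball 0 1) \<inter> ball 0 (1/2))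
              \<le> C * (real_of_ereal (sup_abs u (ball 0 1))) powr \<epsilon> * t powr (- \<epsilon>) \<and>
            measure lebesgue {x \<in> ball 0 (1/2). Theta_lower u (ball 0 1) x > ereal t}
              \<le> C * (real_of_ereal (sup_abs u (ball 0 1))) powr \<epsilon> * t powr (- \<epsilon>)))"
  proof (rule exI[of _ C], rule exI[of _ "2304 * K"], rule exI[of _ \<epsilon>], intro conjI allI impI lower1 lower2)
    fix u :: "real^'n \<Rightarrow> real" and t :: real
    let ?\<Omega> = "ball 0 1 :: (real^'n) set"
    assume u: "continuous_on ?\<Omega> u \<and> visc_pucci_minus_le_0 lam Lam ?\<Omega> u"
      and t: "ereal t > ereal (2304 * K) * sup_abs u ?\<Omega>"
    have "0 < 2304 * K" using K by simp
    then obtain S where S: "sup_abs u ?\<Omega> = ereal S" "0 \<le> S" "\<And>z. z \<in> ?\<Omega> \<Longrightarrow> \<bar>u z\<bar> \<le> S" "2304 * K * S < t"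
      using sup_abs_finite[OF _ _ t] by auto
    have "0 \<le> 2304 * K * S" using S K by simp
    then have "0 < t" using S by linarith
    let ?A = "A_minus t u ?\<Omega> \<inter> ball 0 (1 / 2)"
    have bound: "measure lebesgue ?A \<le> C * S powr \<epsilon> * t powr (- \<epsilon>)"
    \<comment> \<open>For \<open>S = 0\<close> the right-hand side vanishes because
      \<open>0 powr \<epsilon> = 0\<close>, so the bad set has to be null; the decay lemma divides
      by \<open>S\<close>.\<close>
    proof (cases "S = 0")
      case True
      then have "A_minus t u ?\<Omega> = {}" using S(3) \<open>0 < t\<close> by (intro A_minus_zero_on) auto
      then show ?thesis using True by simp
    next
      case False
      then show ?thesis
        unfolding C_def
        using measure_A_minus_power_decay[of lam Lam u S \<kappa> K \<mu> \<epsilon> t] lam u S K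
        by (simp add: n_def \<kappa>_def \<mu>_def \<epsilon>_def)
    qed
    have "open (A_minus t u ?\<Omega>)"
      using open_A_minus[of ?\<Omega> u S t] u S(3) \<open>0 < t\<close> by simp
    then have Am: "?A \<in> lmeasurable"
      by (intro lmeasurable_open) (auto intro: bounded_subset[OF bounded_ball])
    let ?T = "{x \<in> ball 0 (1/2). Theta_lower u ?\<Omega> x > ereal t}"
    have sub: "?T \<subseteq> ?A"
      using Theta_lower_superlevel_subset[of t "ball 0 (1 / 2)" ?\<Omega> u] \<open>0 < t\<close> by (simp add: subset_ball)
    have "measure lebesgue ?T \<le> measure lebesgue ?A"
    \<comment> \<open>\<open>measure\<close> takes the value \<open>0\<close> outside
      \<open>sets lebesgue\<close>, so the bound also holds in the second case.\<close>
    proof (cases "?T \<in> sets lebesgue")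
      case True
      then show ?thesis using sub Am by (intro measure_mono_fmeasurable)
    next
      case False
      then show ?thesis by (simp add: measure_notin_sets)
    qed
    with bound show "measure lebesgue ?T \<le> C * (real_of_ereal (sup_abs u ?\<Omega>)) powr \<epsilon> * t powr (- \<epsilon>)"
      unfolding S(1) by simp
    show "measure lebesgue ?A \<le> C * (real_of_ereal (sup_abs u ?\<Omega>)) powr \<epsilon> * t powr (- \<epsilon>)"
      using bound unfolding S(1) by simp
  qed (use \<open>0 < C\<close> \<open>0 < \<epsilon>\<close> K in auto)
qed

end
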